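(* Let $\Sigma$ be a Riemann surface, $\Gamma\subset\mathrm{Aut}(\Sigma)$ a group of automorphisms, and $\rho:\Gamma\to\mathrm{PGL}_2\mathbb{C}$ a non-trivial homomorphism. Let $f\in\mathfrak{M}_\Gamma$ be a non-constant equivariant function and $g\in\mathfrak{M}^\Gamma$ a non-constant invariant function, and write $\dot f=df/dg$, $\ddot f=d\dot f/dg$. Then the map $$h\;\mapsto\;f+\dot f\,\big(h-\tfrac12\dot f^{-1}\ddot f\big)^{-1}$$ defines a bijection between $\mathfrak{M}^\Gamma$ and the punctured space $\mathfrak{M}_\Gamma-\{f\}$.
   Context: $\Sigma$ is connected. $\mathfrak{M}^\Gamma$ is the field of meromorphic functions $h$ on $\Sigma$ with $h\circ A=h$ for all $A\in\Gamma$. $\mathfrak{M}_\Gamma$ is the set of equivariant functions: meromorphic functions $f$ on $\Sigma$ with $f\circ A=\rho(A)\circ f$ for all $A\in\Gamma$, where $\mathrm{PGL}_2\mathbb{C}$ acts on $\mathbb{CP}^1=\mathbb{C}\cup\{\infty\}$ by Möbius transformations. By convention the constant $\infty$ is regarded as a function $\Sigma\to\mathbb{CP}^1$; it belongs to $\mathfrak{M}_\Gamma$ exactly when $\rho(\Gamma)$ fixes $\infty$, and the displayed expression is read as $\infty$ when $h-\tfrac12\dot f^{-1}\ddot f\equiv0$. *)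

theory Defs
  imports "HOL-Complex_Analysis.Complex_Analysis" "HOL-Algebra.Algebra"
begin

unbundle no fps_syntax

section \<open>Riemann surfaces\<close>

record 'a surface =
  points :: "'a topology"
  charts :: "('a set \<times> ('a \<Rightarrow> complex)) set"

text \<open>The atlas need not be maximal. Second countability is not required: it follows from the
  other conditions by Rado's theorem.\<close>

definition riemann_surface :: "'a surface \<Rightarrow> bool" where
  "riemann_surface S \<longleftrightarrow>
     topspace (points S) \<noteq> {} \<and>
     connected_space (points S) \<and>
     Hausdorff_space (points S) \<and>
     (\<Union>(U, \<phi>)\<in>charts S. U) = topspace (points S) \<and>
     (\<forall>(U, \<phi>)\<in>charts S.
        openin (points S) U \<and> open (\<phi> ` U) \<and>
        homeomorphic_map (subtopology (points S) U) (top_of_set (\<phi> ` U)) \<phi>) \<and>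
     (\<forall>(U, \<phi>)\<in>charts S. \<forall>(V, \<psi>)\<in>charts S.
        (\<psi> \<circ> inv_into U \<phi>) holomorphic_on \<phi> ` (U \<inter> V))"

definition holomorphic_self_map :: "'a surface \<Rightarrow> ('a \<Rightarrow> 'a) \<Rightarrow> bool" where
  "holomorphic_self_map S A \<longleftrightarrow>
     continuous_map (points S) (points S) A \<and>
     (\<forall>(U, \<phi>)\<in>charts S. \<forall>(V, \<psi>)\<in>charts S.
        (\<psi> \<circ> A \<circ> inv_into U \<phi>) holomorphic_on \<phi> ` (U \<inter> A -` V))"

definition Aut :: "'a surface \<Rightarrow> ('a \<Rightarrow> 'a) monoid" where
  "Aut S = (BijGroup (topspace (points S)))
     \<lparr>carrier := {A \<in> Bij (topspace (points S)).
        holomorphic_self_map S A \<and>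
        holomorphic_self_map S (inv_into (topspace (points S)) A)}\<rparr>"

section \<open>The projective linear group and its action on the Riemann sphere\<close>

text \<open>The Riemann sphere is the one-point compactification of the complex plane, carried by
  the type \<^typ>\<open>complex option\<close> with \<^term>\<open>None\<close> as the point at infinity.\<close>

definition riemann_sphere :: "complex option topology" where
  "riemann_sphere = Alexandroff_compactification euclidean"

definition GL2 :: "(complex^2^2) monoid" where
  "GL2 = \<lparr>carrier = {M. invertible M}, mult = (**), one = mat 1\<rparr>"

definition PGL2 :: "(complex^2^2) set monoid" where
  "PGL2 = GL2 Mod {mat c | c. c \<noteq> 0}"

fun moebius_map :: "complex^2^2 \<Rightarrow> complex option \<Rightarrow> complex option" where
  "moebius_map M None =
     (if M$2$1 = 0 then None else Some (M$1$1 / M$2$1))"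
| "moebius_map M (Some z) =
     (if M$2$1 * z + M$2$2 = 0 then None
      else Some (moebius (M$1$1) (M$1$2) (M$2$1) (M$2$2) z))"

text \<open>All representatives of a class in \<^const>\<open>PGL2\<close> induce the same transformation.\<close>

definition pgl_act :: "(complex^2^2) set \<Rightarrow> complex option \<Rightarrow> complex option" where
  "pgl_act K w = (THE v. \<forall>M\<in>K. moebius_map M w = v)"

section \<open>Meromorphic functions on a surface\<close>

text \<open>A meromorphic function takes the value \<^term>\<open>None\<close> exactly at its poles. In particular the
  constant \<^term>\<open>None\<close> is not meromorphic, because poles are isolated. Functions on the surface are
  extensional, so that they are determined by their values on the surface.\<close>

definition meromorphic_function :: "'a surface \<Rightarrow> ('a \<Rightarrow> complex option) \<Rightarrow> bool" where
  "meromorphic_function S f \<longleftrightarrow>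
     f \<in> extensional (topspace (points S)) \<and>
     (\<forall>(U, \<phi>)\<in>charts S. \<exists>F. F nicely_meromorphic_on \<phi> ` U \<and>
        (\<forall>p\<in>U. f p = (if is_pole F (\<phi> p) then None else Some (F (\<phi> p)))))"

definition const_fun :: "'a surface \<Rightarrow> complex option \<Rightarrow> 'a \<Rightarrow> complex option" where
  "const_fun S c = (\<lambda>p\<in>topspace (points S). c)"

definition nonconstant :: "'a surface \<Rightarrow> ('a \<Rightarrow> complex option) \<Rightarrow> bool" where
  "nonconstant S f \<longleftrightarrow> \<not> (\<exists>c. \<forall>p\<in>topspace (points S). f p = c)"

text \<open>Continuous extension to the whole surface of a function that is given off a discrete set;
  the values of \<open>u\<close> on that set are irrelevant. Sums and products of meromorphic functions are
  computed pointwise off the poles and then extended.\<close>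

definition extend :: "'a surface \<Rightarrow> ('a \<Rightarrow> complex) \<Rightarrow> 'a \<Rightarrow> complex option" where
  "extend S u = (\<lambda>p\<in>topspace (points S).
     THE w. limitin riemann_sphere (\<lambda>q. Some (u q)) w (atin (points S) p))"

definition mero_field :: "'a surface \<Rightarrow> ('a \<Rightarrow> complex option) ring" where
  "mero_field S =
     \<lparr>carrier = {f. meromorphic_function S f},
      mult = (\<lambda>f g. extend S (\<lambda>q. the (f q) * the (g q))),
      one = const_fun S (Some 1),
      ring.zero = const_fun S (Some 0),
      ring.add = (\<lambda>f g. extend S (\<lambda>q. the (f q) + the (g q)))\<rparr>"

text \<open>The quotient \<open>df/dg\<close> of the differentials, for \<open>g\<close> nonconstant: in every chart it is the
  quotient of the derivatives of the coordinate expressions, and by the chain rule this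
  quotient does not depend on the chart.\<close>

definition chart_deriv ::
    "'a set \<Rightarrow> ('a \<Rightarrow> complex) \<Rightarrow> ('a \<Rightarrow> complex option) \<Rightarrow> 'a \<Rightarrow> complex" where
  "chart_deriv U \<phi> f q = deriv (\<lambda>z. the (f (inv_into U \<phi> z))) (\<phi> q)"

definition diff_quot ::
    "'a surface \<Rightarrow> ('a \<Rightarrow> complex option) \<Rightarrow> ('a \<Rightarrow> complex option) \<Rightarrow> 'a \<Rightarrow> complex option" where
  "diff_quot S f g = (\<lambda>p\<in>topspace (points S).
     THE w. \<forall>(U, \<phi>)\<in>charts S. p \<in> U \<longrightarrow>
       limitin riemann_sphere (\<lambda>q. Some (chart_deriv U \<phi> f q / chart_deriv U \<phi> g q)) w
         (atin (points S) p))"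

section \<open>Invariant and equivariant functions\<close>

definition invariant_functions ::
    "'a surface \<Rightarrow> ('a \<Rightarrow> 'a) set \<Rightarrow> ('a \<Rightarrow> complex option) set" where
  "invariant_functions S \<Gamma> =
     {h \<in> carrier (mero_field S). \<forall>A\<in>\<Gamma>. \<forall>p\<in>topspace (points S). h (A p) = h p}"

definition equivariant_functions ::
    "'a surface \<Rightarrow> ('a \<Rightarrow> 'a) set \<Rightarrow> (('a \<Rightarrow> 'a) \<Rightarrow> (complex^2^2) set) \<Rightarrow>
     ('a \<Rightarrow> complex option) set" where
  "equivariant_functions S \<Gamma> \<rho> =
     {f \<in> carrier (mero_field S) \<union> {const_fun S None}.
        \<forall>A\<in>\<Gamma>. \<forall>p\<in>topspace (points S). f (A p) = pgl_act (\<rho> A) (f p)}"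

end

theory Submission
  imports Defs
begin

text \<open>Identify a meromorphic function with its complex values off a discrete set; the identity theorem
  and continuity into the Riemann sphere make this faithful. If \<open>f \<circ> A = (a f + b) / (c f + d)\<close> and
  \<open>g \<circ> A = g\<close>, differentiating twice with respect to \<open>g\<close> shows that \<open>s = f'' / (2 f')\<close> satisfies
  \<open>s \<circ> A = s - c f' / (c f + d)\<close>. On the other hand, \<open>F = f + f' / x\<close> is equivariant if and only if
  \<open>x \<circ> A = x + c f' / (c f + d)\<close> for all \<open>A\<close>, so these \<open>x\<close> are exactly the functions \<open>h - s\<close> with
  \<open>h\<close> invariant. The degenerate value \<open>x = 0\<close> is the constant \<open>\<infinity>\<close>: it is equivariant precisely when
  all the entries \<open>c\<close> vanish, that is, when \<open>s\<close> itself is invariant.\<close>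

text \<open>Origin of the formula: with z = 1/h the expression f + f' / (h - f''/(2 f')) expands as
  f + f' z + (f''/2) z^2 + ..., so it is the Moebius transformation in z that osculates f to second
  order, with g as the local parameter. The factor 1/2 is that of the second Taylor coefficient, and
  s is the pole of the transformation in h. A Moebius transformation is determined by its 2-jet, so
  the osculating transformation of M o f is M composed with that of f. When g is invariant and f
  equivariant, the osculating transformation at A p is therefore M composed with the one at p, and
  this is why it exchanges invariant and equivariant functions. The parameter value h = infinity is
  the only one that returns f itself; it is not a meromorphic function, which accounts for the
  puncture. The obstacle is that sums, products and derivatives of sphere-valued functions are
  limits, while negatives and inverses are definite descriptions. None of them can be computed at a
  given point directly.\<close>

unbundle no Formal_Power_Series.fps_syntax

section \<open>The Riemann sphere and the action of the projective linear group\<close>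

lemma topspace_riemann_sphere: "topspace riemann_sphere = UNIV"
  by (simp add: riemann_sphere_def UNIV_option_conv)

lemma limitin_sphere_Some:
  "limitin riemann_sphere (\<lambda>q. Some (u q)) (Some z) F \<longleftrightarrow> (u \<longlongrightarrow> z) F"
proof
  assume L: "limitin riemann_sphere (\<lambda>q. Some (u q)) (Some z) F"
  show "(u \<longlongrightarrow> z) F"
  proof (rule topological_tendstoI)
    fix V assume V: "open V" "z \<in> V"
    then have "openin riemann_sphere (Some ` V)" "Some z \<in> Some ` V"
      by (auto simp: riemann_sphere_def)
    then have "\<forall>\<^sub>F q in F. Some (u q) \<in> Some ` V"
      using L by (auto simp: limitin_def)
    then show "\<forall>\<^sub>F q in F. u q \<in> V"
      by eventually_elim auto
  qed
next
  assume T: "(u \<longlongrightarrow> z) F"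
  show "limitin riemann_sphere (\<lambda>q. Some (u q)) (Some z) F"
    unfolding limitin_def
  proof (intro conjI allI impI)
    show "Some z \<in> topspace riemann_sphere"
      by (simp add: riemann_sphere_def)
    fix W assume W: "openin riemann_sphere W \<and> Some z \<in> W"
    have "openin euclidean {x \<in> topspace euclidean. Some x \<in> W}"
      by (rule openin_continuous_map_preimage[OF continuous_map_Some])
         (use W in \<open>simp add: riemann_sphere_def\<close>)
    then have "open {x. Some x \<in> W}" by simp
    with T W show "\<forall>\<^sub>F q in F. Some (u q) \<in> W"
      using topological_tendstoD[of u z F "{x. Some x \<in> W}"] by simp
  qed
qed

lemma limitin_sphere_None:
  "limitin riemann_sphere (\<lambda>q. Some (u q)) None F \<longleftrightarrow> filterlim u at_infinity F"
proof
  assume L: "limitin riemann_sphere (\<lambda>q. Some (u q)) None F"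
  show "filterlim u at_infinity F"
    unfolding filterlim_iff
  proof (intro allI impI)
    fix P :: "complex \<Rightarrow> bool" assume "eventually P at_infinity"
    then obtain b where b: "\<And>x. b \<le> norm x \<Longrightarrow> P x"
      by (auto simp: eventually_at_infinity)
    have "openin riemann_sphere (insert None (Some ` (topspace euclidean - cball 0 b)))"
      unfolding riemann_sphere_def openin_Alexandroff_compactification
      by (intro disjI2 exI[of _ "cball 0 b"]) auto
    then have "\<forall>\<^sub>F q in F. Some (u q) \<in> insert None (Some ` (topspace euclidean - cball 0 b))"
      using L unfolding limitin_def by blast
    then show "\<forall>\<^sub>F q in F. P (u q)"
      by eventually_elim (auto intro: b)
  qed
next
  assume T: "filterlim u at_infinity F"
  show "limitin riemann_sphere (\<lambda>q. Some (u q)) None F"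
    unfolding limitin_def
  proof (intro conjI allI impI)
    show "None \<in> topspace riemann_sphere"
      by (simp add: riemann_sphere_def)
    fix W assume "openin riemann_sphere W \<and> None \<in> W"
    then obtain C where C: "compact C" "W = insert None (Some ` (- C))"
      unfolding riemann_sphere_def openin_Alexandroff_compactification
      by (auto simp: Compl_eq_Diff_UNIV)
    obtain b where b: "\<And>x. x \<in> C \<Longrightarrow> norm x \<le> b"
      using compact_imp_bounded[OF C(1)] by (auto simp: bounded_iff)
    have "eventually (\<lambda>x. b + 1 \<le> norm x) (at_infinity :: complex filter)"
      by (auto simp: eventually_at_infinity)
    with T have "\<forall>\<^sub>F q in F. b + 1 \<le> norm (u q)"
      by (auto simp: filterlim_iff)
    then show "\<forall>\<^sub>F q in F. Some (u q) \<in> W"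
      by eventually_elim (use b C in fastforce)
  qed
qed

lemma Hausdorff_riemann_sphere: "Hausdorff_space riemann_sphere"
  unfolding riemann_sphere_def Hausdorff_space_Alexandroff_compactification
  by (simp add: Hausdorff_space_euclidean locally_compact_space_euclidean)

text \<open>Division with remainder leaves a single term that depends on z, so the limit for z
  tending to infinity can be read off.\<close>

lemma moebius_split:
  fixes a b c d z :: complex
  assumes "c \<noteq> 0" "c * z + d \<noteq> 0"
  shows "a / c - (a * d - b * c) / c / (c * z + d) = (a * z + b) / (c * z + d)"
  using assms by (simp add: divide_simps) (simp add: algebra_simps)

text \<open>Continuity of a Moebius transformation on the sphere, in the form needed for functions
  that are finite off a discrete set: only the limit \<open>w\<close> and its image may be infinite.
  The nonzero determinant prevents numerator and denominator from vanishing together.\<close>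

lemma limitin_sphere_moebius:
  fixes M :: "complex^2^2"
  assumes det: "M$1$1 * M$2$2 \<noteq> M$1$2 * M$2$1"
    and L: "limitin riemann_sphere (\<lambda>q. Some (u q)) w F"
    and v: "\<forall>\<^sub>F q in F. moebius_map M (Some (u q)) = Some (v q)"
  shows "limitin riemann_sphere (\<lambda>q. Some (v q)) (moebius_map M w) F"
proof -
  define a b c d where abcd: "a = M$1$1" "b = M$1$2" "c = M$2$1" "d = M$2$2"
  have det: "a * d - b * c \<noteq> 0" using det by (simp add: abcd)
  have "\<forall>\<^sub>F q in F. (a * u q + b) / (c * u q + d) = v q \<and> c * u q + d \<noteq> 0"
    using v by eventually_elim (auto simp: abcd moebius_def split: if_splits)
  then have v: "\<forall>\<^sub>F q in F. (a * u q + b) / (c * u q + d) = v q" "\<forall>\<^sub>F q in F. c * u q + d \<noteq> 0"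
    by (auto elim: eventually_mono)
  show ?thesis
  proof (cases w)
    case (Some z)
    have u: "(u \<longlongrightarrow> z) F" using L Some by (simp add: limitin_sphere_Some)
    show ?thesis
    proof (cases "c * z + d = 0")
      case True
      have "a * z + b \<noteq> 0"
      proof
        assume ab: "a * z + b = 0"
        have "a * d - b * c = a * (c * z + d) - c * (a * z + b)" by (simp add: algebra_simps)
        with ab True det show False by simp
      qed
      moreover have "((\<lambda>q. a * u q + b) \<longlongrightarrow> a * z + b) F"
        by (intro tendsto_intros u)
      moreover have "((\<lambda>q. c * u q + d) \<longlongrightarrow> c * z + d) F"
        by (intro tendsto_intros u)
      ultimately have "filterlim (\<lambda>q. (a * u q + b) / (c * u q + d)) at_infinity F"
        unfolding divide_inverse using True v(2)
        by (intro tendsto_mult_filterlim_at_infinity filterlim_compose[OF filterlim_inverse_at_infinity])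
           (auto simp: filterlim_at)
      then have "filterlim v at_infinity F"
        using filterlim_cong[OF refl refl v(1)] by simp
      then show ?thesis using Some True by (simp add: limitin_sphere_None abcd)
    next
      case False
      then have "((\<lambda>q. (a * u q + b) / (c * u q + d)) \<longlongrightarrow> (a * z + b) / (c * z + d)) F"
        by (intro tendsto_intros u)
      then have "(v \<longlongrightarrow> (a * z + b) / (c * z + d)) F"
        using tendsto_cong[OF v(1)] by simp
      then show ?thesis using Some False by (simp add: limitin_sphere_Some abcd moebius_def)
    qed
  next
    case None
    have u: "filterlim u at_infinity F" using L None by (simp add: limitin_sphere_None)
    show ?thesis
    proof (cases "c = 0")
      case True
      then have "a \<noteq> 0" "d \<noteq> 0" using det by auto
      have "filterlim (\<lambda>q. a * u q) at_infinity F"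
        by (rule tendsto_mult_filterlim_at_infinity[OF tendsto_const \<open>a \<noteq> 0\<close> u])
      then have "filterlim (\<lambda>q. b + a * u q) at_infinity F"
        by (rule tendsto_add_filterlim_at_infinity[OF tendsto_const])
      then have "filterlim (\<lambda>q. (1 / d) * (b + a * u q)) at_infinity F"
        using \<open>d \<noteq> 0\<close> by (intro tendsto_mult_filterlim_at_infinity[OF tendsto_const]) auto
      moreover have "\<forall>\<^sub>F q in F. (1 / d) * (b + a * u q) = v q"
        using v(1) by eventually_elim (simp add: True add.commute)
      ultimately have "filterlim v at_infinity F"
        using filterlim_cong[OF refl refl] by fast
      then show ?thesis using None True by (simp add: limitin_sphere_None abcd)
    next
      case False
      have "filterlim (\<lambda>q. c * u q) at_infinity F"
        by (rule tendsto_mult_filterlim_at_infinity[OF tendsto_const \<open>c \<noteq> 0\<close> u])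
      then have "filterlim (\<lambda>q. d + c * u q) at_infinity F"
        by (rule tendsto_add_filterlim_at_infinity[OF tendsto_const])
      then have "((\<lambda>q. (a * d - b * c) / c / (d + c * u q)) \<longlongrightarrow> 0) F"
        by (rule tendsto_divide_0[OF tendsto_const])
      then have "((\<lambda>q. a / c - (a * d - b * c) / c / (d + c * u q)) \<longlongrightarrow> a / c - 0) F"
        by (intro tendsto_intros)
      moreover have "\<forall>\<^sub>F q in F. a / c - (a * d - b * c) / c / (d + c * u q) = v q"
        using v(1,2)
        by eventually_elim (metis False add.commute moebius_split)
      ultimately have "(v \<longlongrightarrow> a / c) F"
        using tendsto_cong by fastforce
      then show ?thesis using None False by (simp add: limitin_sphere_Some abcd)
    qed
  qed
qed

text \<open>The members of a coset differ by nonzero scalars, which cancel in the quotient, so the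
  description in \<open>pgl_act\<close> is well defined. From here on a matrix with nonzero
  determinant stands for its class.\<close>

lemma pgl_act_eq_moebius_map:
  assumes "K \<in> carrier PGL2"
  obtains M :: "complex^2^2" where "M$1$1 * M$2$2 \<noteq> M$1$2 * M$2$1" "pgl_act K = moebius_map M"
proof -
  obtain M :: "complex^2^2" where M: "invertible M"
      and K: "K = {mat c | c. c \<noteq> 0} #>\<^bsub>GL2\<^esub> M"
    using assms by (auto simp: PGL2_def FactGroup_def RCOSETS_def GL2_def)
  have K': "K = {mat c ** M | c. c \<noteq> 0}"
    using K by (auto simp: r_coset_def GL2_def)
  have ent: "(mat c ** M) $ i $ j = c * M $ i $ j" for c :: complex and i j :: 2
    using exhaust_2[of i]
    by (auto simp: matrix_matrix_mult_def mat_def sum_2)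
  have same: "moebius_map (mat c ** M) w = moebius_map M w" if "c \<noteq> 0" for c w
  proof (cases w)
    case (Some z)
    have "c * x * z + c * y = c * (x * z + y)" for x y by (simp add: algebra_simps)
    with that Some show ?thesis by (simp add: ent moebius_def)
  qed (use that in \<open>simp add: ent\<close>)
  have "M \<in> K" using K' by (auto intro!: exI[of _ 1])
  then have "pgl_act K w = moebius_map M w" for w
    unfolding pgl_act_def using same K' by (intro the_equality) auto
  moreover have "M$1$1 * M$2$2 \<noteq> M$1$2 * M$2$1"
    using M by (simp add: invertible_det_nz det_2)
  ultimately show ?thesis using that by blast
qed

section \<open>Coordinate representatives of meromorphic functions\<close>

text \<open>A property holds eventually along this filter if and only if it holds off a closed discrete subset
  of the surface.\<close>

definition codiscrete :: "'a surface \<Rightarrow> 'a filter" where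
  "codiscrete S = (SUP p\<in>topspace (points S). atin (points S) p)"

lemma eventually_codiscrete:
  "eventually P (codiscrete S) \<longleftrightarrow>
     (\<forall>p\<in>topspace (points S). eventually P (atin (points S) p))"
  by (simp add: codiscrete_def eventually_Sup)

text \<open>A finite-valued stand-in for a meromorphic function: the value at a pole is arbitrary,
  so it is only meaningful up to changes on a discrete set.\<close>

definition mero_coord :: "'a surface \<Rightarrow> ('a \<Rightarrow> complex) \<Rightarrow> bool" where
  "mero_coord S u \<longleftrightarrow> (\<forall>(U, \<phi>)\<in>charts S. (\<lambda>z. u (inv_into U \<phi> z)) meromorphic_on \<phi> ` U)"

definition analytic_at_point :: "'a surface \<Rightarrow> ('a \<Rightarrow> complex) \<Rightarrow> 'a \<Rightarrow> bool" where
  "analytic_at_point S u q \<longleftrightarrow>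
     (\<forall>(U, \<phi>)\<in>charts S. q \<in> U \<longrightarrow> (\<lambda>z. u (inv_into U \<phi> z)) analytic_on {\<phi> q})"

definition chart_at :: "'a surface \<Rightarrow> 'a \<Rightarrow> 'a set \<times> ('a \<Rightarrow> complex)" where
  "chart_at S q = (SOME c. c \<in> charts S \<and> q \<in> fst c)"

text \<open>By the chain rule the chart is irrelevant wherever both functions are analytic; elsewhere the
  value is junk.\<close>

definition deriv_quot :: "'a surface \<Rightarrow> ('a \<Rightarrow> complex) \<Rightarrow> ('a \<Rightarrow> complex) \<Rightarrow> 'a \<Rightarrow> complex" where
  "deriv_quot S u g q =
     (case chart_at S q of (U, \<phi>) \<Rightarrow>
        deriv (\<lambda>z. u (inv_into U \<phi> z)) (\<phi> q) / deriv (\<lambda>z. g (inv_into U \<phi> z)) (\<phi> q))"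

text \<open>Away from essential singularities, zeros that accumulate at a point force the function
  to vanish on a punctured neighbourhood.\<close>

lemma meromorphic_eventually_zero_or_nonzero:
  assumes "f meromorphic_on {z}"
  shows "(\<forall>\<^sub>F w in at z. f w = 0) \<or> (\<forall>\<^sub>F w in at z. f w \<noteq> 0)"
  using not_essential_frequently_0_imp_eventually_0[of f z] assms
  by (auto simp: meromorphic_at_iff frequently_def)

lemma limitin_filtermap: "limitin Y f l (filtermap g F) \<longleftrightarrow> limitin Y (\<lambda>x. f (g x)) l F"
  by (simp add: limitin_def eventually_filtermap)

section \<open>Charts and punctured neighbourhoods\<close>

locale Riemann_surface =
  fixes S :: "'a surface"
  assumes riemann_surface: "riemann_surface S"
begin

abbreviation "carr \<equiv> topspace (points S)"
abbreviation "ae \<equiv> codiscrete S"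

lemma chartD:
  assumes "(U, \<phi>) \<in> charts S"
  shows "openin (points S) U" "open (\<phi> ` U)"
    "homeomorphic_map (subtopology (points S) U) (top_of_set (\<phi> ` U)) \<phi>"
    "U \<subseteq> carr" "inj_on \<phi> U"
proof -
  show 1: "openin (points S) U" and "open (\<phi> ` U)"
    and 3: "homeomorphic_map (subtopology (points S) U) (top_of_set (\<phi> ` U)) \<phi>"
    using riemann_surface assms unfolding riemann_surface_def by auto
  show 4: "U \<subseteq> carr" using 1 by (rule openin_subset)
  show "inj_on \<phi> U"
    using homeomorphic_imp_injective_map[OF 3] 4 by (simp add: Int_absorb1)
qed

lemma chart_exists:
  assumes "p \<in> carr"
  obtains U \<phi> where "(U, \<phi>) \<in> charts S" "p \<in> U"
proof -
  have "(\<Union>(U, \<phi>)\<in>charts S. U) = carr"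
    using riemann_surface by (simp add: riemann_surface_def)
  with assms that show ?thesis by blast
qed

lemma chart_image_open:
  assumes c: "(U, \<phi>) \<in> charts S" and "openin (points S) V"
  shows "open (\<phi> ` (U \<inter> V))"
proof -
  have "openin (subtopology (points S) U) (U \<inter> V)"
    using assms by (metis inf_commute openin_subtopology_Int)
  then have "openin (top_of_set (\<phi> ` U)) (\<phi> ` (U \<inter> V))"
    using homeomorphic_imp_open_map[OF chartD(3)[OF c]] by (simp add: open_map_def)
  then show ?thesis
    using chartD(2)[OF c] openin_open_trans by blast
qed

text \<open>The bridge to complex analysis in the plane: a chart is a homeomorphism onto an open
  set, and its injectivity keeps the puncture at the right point.\<close>

lemma eventually_atin_chart:
  assumes c: "(U, \<phi>) \<in> charts S" and p: "p \<in> U"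
  shows "eventually P (atin (points S) p) \<longleftrightarrow>
         eventually (\<lambda>z. P (inv_into U \<phi> z)) (at (\<phi> p))"
proof
  have inj: "inj_on \<phi> U" by (rule chartD[OF c])
  assume "eventually P (atin (points S) p)"
  then obtain V where V: "openin (points S) V" "p \<in> V" "\<forall>x\<in>V - {p}. P x"
    using p chartD(4)[OF c] by (auto simp: eventually_atin)
  show "eventually (\<lambda>z. P (inv_into U \<phi> z)) (at (\<phi> p))"
    unfolding eventually_at_topological
  proof (intro exI[of _ "\<phi> ` (U \<inter> V)"] conjI ballI impI)
    show "open (\<phi> ` (U \<inter> V))" by (rule chart_image_open[OF c V(1)])
    show "\<phi> p \<in> \<phi> ` (U \<inter> V)" using p V by auto
    fix z assume "z \<in> \<phi> ` (U \<inter> V)" "z \<noteq> \<phi> p"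
    then obtain x where "x \<in> U" "x \<in> V" "x \<noteq> p" "z = \<phi> x" by auto
    then show "P (inv_into U \<phi> z)" using V inj by simp
  qed
next
  have inj: "inj_on \<phi> U" by (rule chartD[OF c])
  assume "eventually (\<lambda>z. P (inv_into U \<phi> z)) (at (\<phi> p))"
  then obtain W where W: "open W" "\<phi> p \<in> W" "\<And>z. z \<in> W \<Longrightarrow> z \<noteq> \<phi> p \<Longrightarrow> P (inv_into U \<phi> z)"
    unfolding eventually_at_topological by blast
  let ?V = "{x \<in> topspace (subtopology (points S) U). \<phi> x \<in> \<phi> ` U \<inter> W}"
  have "openin (subtopology (points S) U) ?V"
    by (rule openin_continuous_map_preimage[OF homeomorphic_imp_continuous_map[OF chartD(3)[OF c]]])
       (use W in \<open>simp add: openin_open_Int\<close>)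
  then have "openin (points S) ?V"
    using chartD(1)[OF c] openin_trans_full by blast
  moreover have "p \<in> ?V" using p W chartD(4)[OF c] by auto
  moreover have "\<forall>x\<in>?V - {p}. P x"
  proof
    fix x assume x: "x \<in> ?V - {p}"
    then have "\<phi> x \<noteq> \<phi> p" using p inj by (auto dest: inj_onD)
    then show "P x" using W(3)[of "\<phi> x"] x inj by auto
  qed
  ultimately show "eventually P (atin (points S) p)"
    unfolding eventually_atin by blast
qed

lemma atin_chart:
  assumes "(U, \<phi>) \<in> charts S" "p \<in> U"
  shows "atin (points S) p = filtermap (inv_into U \<phi>) (at (\<phi> p))"
  using eventually_atin_chart[OF assms] by (simp add: filter_eq_iff eventually_filtermap)

lemma atin_neq_bot: "p \<in> carr \<Longrightarrow> atin (points S) p \<noteq> bot"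
  by (metis atin_chart at_neq_bot chart_exists filtermap_bot_iff)

lemma codiscrete_neq_bot: "ae \<noteq> bot"
proof -
  have "carr \<noteq> {}" using riemann_surface unfolding riemann_surface_def by blast
  then obtain p where "p \<in> carr" by blast
  then show ?thesis
    using atin_neq_bot[of p] eventually_codiscrete[of "\<lambda>_. False" S]
    by (auto simp: trivial_limit_def)
qed

lemma eventually_codiscrete_in_surface: "\<forall>\<^sub>F q in ae. q \<in> carr"
  unfolding eventually_codiscrete
  using openin_topspace by (fastforce simp: eventually_atin)

lemma eventually_atin_spread:
  assumes "eventually P (atin (points S) p)" "p \<in> carr"
  obtains V where "openin (points S) V" "p \<in> V"
    "\<And>q. q \<in> V - {p} \<Longrightarrow> eventually P (nhdsin (points S) q)"
proof -
  obtain V where V: "openin (points S) V" "p \<in> V" "\<forall>x\<in>V - {p}. P x"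
    using assms by (auto simp: eventually_atin)
  have "t1_space (points S)"
    using riemann_surface Hausdorff_imp_t1_space by (auto simp: riemann_surface_def)
  then have "openin (points S) (V - {p})"
    using V(1) by (simp add: t1_space_openin_delete_alt)
  then have "eventually P (nhdsin (points S) q)" if "q \<in> V - {p}" for q
    using V(3) that unfolding eventually_nhdsin by blast
  with V that show ?thesis by blast
qed

lemma eventually_nhdsin_imp_atin:
  "eventually P (nhdsin (points S) q) \<Longrightarrow> eventually P (atin (points S) q)"
  by (auto simp: eventually_nhdsin eventually_atin)

text \<open>A derivative at \<open>q\<close> depends on a full neighbourhood of \<open>q\<close>. An
  identity off a discrete set may be differentiated because, points being closed, it holds on such a
  neighbourhood for almost every \<open>q\<close>.\<close>

lemma eventually_eventually_codiscrete:
  assumes "eventually P ae"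
  shows "\<forall>\<^sub>F q in ae. eventually P (nhdsin (points S) q)"
  unfolding eventually_codiscrete
proof
  fix p assume p: "p \<in> carr"
  then have "eventually P (atin (points S) p)" using assms by (simp add: eventually_codiscrete)
  then show "\<forall>\<^sub>F q in atin (points S) p. eventually P (nhdsin (points S) q)"
    by (rule eventually_atin_spread[OF _ p]) (auto simp: eventually_atin)
qed

lemma openin_eventually_atin: "openin (points S) {p \<in> carr. eventually P (atin (points S) p)}"
proof (subst openin_subopen, intro ballI)
  fix p assume p: "p \<in> {p \<in> carr. eventually P (atin (points S) p)}"
  then obtain V where "openin (points S) V" "p \<in> V"
    "\<And>q. q \<in> V - {p} \<Longrightarrow> eventually P (nhdsin (points S) q)"
    by (auto elim: eventually_atin_spread)
  then show "\<exists>T. openin (points S) T \<and> p \<in> T \<and> T \<subseteq> {p \<in> carr. eventually P (atin (points S) p)}"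
    using p openin_subset eventually_nhdsin_imp_atin by (intro exI[of _ V]) blast
qed

section \<open>Finite-valued meromorphic functions and the identity theorem\<close>

lemma mero_coord_at:
  assumes "mero_coord S u" "(U, \<phi>) \<in> charts S" "p \<in> U"
  shows "(\<lambda>z. u (inv_into U \<phi> z)) meromorphic_on {\<phi> p}"
  using assms unfolding mero_coord_def by (auto intro: meromorphic_on_subset)

lemma mero_coordI:
  assumes "\<And>U \<phi> p. (U, \<phi>) \<in> charts S \<Longrightarrow> p \<in> U \<Longrightarrow> (\<lambda>z. u (inv_into U \<phi> z)) meromorphic_on {\<phi> p}"
  shows "mero_coord S u"
  using assms unfolding mero_coord_def by (subst meromorphic_on_meromorphic_at) auto

lemma mero_coord_intros:
  "mero_coord S (\<lambda>q. c)"
  "mero_coord S u \<Longrightarrow> mero_coord S v \<Longrightarrow> mero_coord S (\<lambda>q. u q + v q)"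
  "mero_coord S u \<Longrightarrow> mero_coord S v \<Longrightarrow> mero_coord S (\<lambda>q. u q - v q)"
  "mero_coord S u \<Longrightarrow> mero_coord S v \<Longrightarrow> mero_coord S (\<lambda>q. u q * v q)"
  "mero_coord S u \<Longrightarrow> mero_coord S v \<Longrightarrow> mero_coord S (\<lambda>q. u q / v q)"
  "mero_coord S u \<Longrightarrow> mero_coord S (\<lambda>q. - u q)"
  unfolding mero_coord_def by (auto intro!: meromorphic_intros)

lemma mero_coord_cong:
  assumes "\<forall>\<^sub>F q in ae. u q = v q"
  shows "mero_coord S u \<longleftrightarrow> mero_coord S v"
  unfolding mero_coord_def
proof (intro ball_cong refl, clarify)
  fix U \<phi> assume c: "(U, \<phi>) \<in> charts S"
  show "((\<lambda>z. u (inv_into U \<phi> z)) meromorphic_on \<phi> ` U) =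
        ((\<lambda>z. v (inv_into U \<phi> z)) meromorphic_on \<phi> ` U)"
  proof (rule meromorphic_on_cong)
    fix z assume "z \<in> \<phi> ` U"
    then obtain p where p: "p \<in> U" "z = \<phi> p" by blast
    then have "\<forall>\<^sub>F q in atin (points S) p. u q = v q"
      using assms chartD(4)[OF c] by (auto simp: eventually_codiscrete)
    then show "\<forall>\<^sub>F z in at z. u (inv_into U \<phi> z) = v (inv_into U \<phi> z)"
      unfolding eventually_atin_chart[OF c p(1)] p(2) .
  qed simp
qed

text \<open>The identity theorem. Each point has a punctured neighbourhood on which \<open>u\<close>
  is identically zero or nowhere zero; both kinds of points form open sets, disjoint because
  punctured neighbourhoods are nonempty, and the surface is connected.\<close>

lemma mero_coord_zero_or_nonzero:
  assumes "mero_coord S u"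
  shows "(\<forall>\<^sub>F q in ae. u q = 0) \<or> (\<forall>\<^sub>F q in ae. u q \<noteq> 0)"
proof -
  let ?E = "{p \<in> carr. \<forall>\<^sub>F q in atin (points S) p. u q = 0}"
  let ?N = "{p \<in> carr. \<forall>\<^sub>F q in atin (points S) p. u q \<noteq> 0}"
  have "carr \<subseteq> ?E \<union> ?N"
  proof
    fix p assume p: "p \<in> carr"
    then obtain U \<phi> where c: "(U, \<phi>) \<in> charts S" "p \<in> U" by (rule chart_exists)
    show "p \<in> ?E \<union> ?N"
      using p meromorphic_eventually_zero_or_nonzero[OF mero_coord_at[OF assms c]]
      by (simp add: eventually_atin_chart[OF c])
  qed
  moreover have "?E \<inter> ?N = {}"
  proof -
    have False if "p \<in> ?E" "p \<in> ?N" for p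
    proof -
      have "\<forall>\<^sub>F q in atin (points S) p. u q = 0" "\<forall>\<^sub>F q in atin (points S) p. u q \<noteq> 0"
        using that by auto
      then have "\<forall>\<^sub>F q in atin (points S) p. False"
        by eventually_elim simp
      then show False using that atin_neq_bot[of p] by (simp add: trivial_limit_def)
    qed
    then show ?thesis by blast
  qed
  moreover have "connected_space (points S)"
    using riemann_surface by (simp add: riemann_surface_def)
  ultimately have "?E = {} \<or> ?N = {}"
    using openin_eventually_atin unfolding connected_space_def by blast
  then show ?thesis using \<open>carr \<subseteq> ?E \<union> ?N\<close> by (auto simp: eventually_codiscrete)
qed

section \<open>Passage between finite-valued and sphere-valued functions\<close>

lemma limitin_atin_unique:
  assumes "p \<in> carr" "limitin riemann_sphere f v (atin (points S) p)"
    "limitin riemann_sphere f w (atin (points S) p)"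
  shows "v = w"
  using assms limitin_Hausdorff_unique[OF assms(2,3)] atin_neq_bot Hausdorff_riemann_sphere by simp

lemma
  assumes "meromorphic_function S f"
  shows meromorphic_function_limit:
      "p \<in> carr \<Longrightarrow> limitin riemann_sphere f (f p) (atin (points S) p)"
    and meromorphic_function_finite: "\<forall>\<^sub>F q in ae. f q = Some (the (f q))"
    and mero_coord_the: "mero_coord S (\<lambda>q. the (f q))"
proof -
  \<comment> \<open>Near \<open>\<phi> p\<close> the local function \<open>F\<close> is analytic
    except possibly at \<open>\<phi> p\<close> itself, hence has no other poles there, and the
    infinite branch in \<open>meromorphic_function\<close> cannot occur. All three claims follow
    from this comparison.\<close>
  have local: "\<exists>F. F meromorphic_on {\<phi> p} \<and> (\<forall>\<^sub>F z in at (\<phi> p). f (inv_into U \<phi> z) = Some (F z)) \<and>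
      limitin riemann_sphere (\<lambda>z. Some (F z)) (f p) (at (\<phi> p))"
    if c: "(U, \<phi>) \<in> charts S" and p: "p \<in> U" for U \<phi> p
  proof -
    obtain F where F: "F nicely_meromorphic_on \<phi> ` U"
      "\<forall>p\<in>U. f p = (if is_pole F (\<phi> p) then None else Some (F (\<phi> p)))"
      using assms c unfolding meromorphic_function_def by blast
    have mero: "F meromorphic_on {\<phi> p}"
      using F(1) p unfolding nicely_meromorphic_on_def by (auto intro: meromorphic_on_subset)
    then have "\<forall>\<^sub>F z in at (\<phi> p). F analytic_on {z}"
      by (simp add: meromorphic_at_iff isolated_singularity_at_altdef)
    moreover have "\<forall>\<^sub>F z in at (\<phi> p). z \<in> \<phi> ` U"
      using p chartD(2)[OF c] by (intro eventually_at_in_open') auto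
    ultimately have ev: "\<forall>\<^sub>F z in at (\<phi> p). f (inv_into U \<phi> z) = Some (F z)"
    proof eventually_elim
      case (elim z)
      then obtain x where x: "x \<in> U" "z = \<phi> x" by blast
      have "\<not> is_pole F z" using elim(1) by (rule analytic_at_imp_no_pole)
      then show ?case using x F(2) chartD(5)[OF c] by simp
    qed
    have "limitin riemann_sphere (\<lambda>z. Some (F z)) (f p) (at (\<phi> p))"
      using F p unfolding nicely_meromorphic_on_def
      by (auto simp: limitin_sphere_Some limitin_sphere_None is_pole_def)
    with mero ev show ?thesis by blast
  qed
  show "limitin riemann_sphere f (f p) (atin (points S) p)" if p: "p \<in> carr" for p
  proof -
    obtain U \<phi> where c: "(U, \<phi>) \<in> charts S" "p \<in> U" using p by (rule chart_exists)
    obtain F where F: "\<forall>\<^sub>F z in at (\<phi> p). f (inv_into U \<phi> z) = Some (F z)"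
      "limitin riemann_sphere (\<lambda>z. Some (F z)) (f p) (at (\<phi> p))"
      using local[OF c] by blast
    show ?thesis
      unfolding atin_chart[OF c] limitin_filtermap
      by (rule limitin_transform_eventually[OF _ F(2)]) (use F(1) in eventually_elim, simp)
  qed
  show "\<forall>\<^sub>F q in ae. f q = Some (the (f q))"
    unfolding eventually_codiscrete
  proof
    fix p assume "p \<in> carr"
    then obtain U \<phi> where c: "(U, \<phi>) \<in> charts S" "p \<in> U" by (rule chart_exists)
    obtain F where "\<forall>\<^sub>F z in at (\<phi> p). f (inv_into U \<phi> z) = Some (F z)"
      using local[OF c] by blast
    then show "\<forall>\<^sub>F q in atin (points S) p. f q = Some (the (f q))"
      unfolding eventually_atin_chart[OF c] by eventually_elim simp
  qed
  show "mero_coord S (\<lambda>q. the (f q))"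
  proof (rule mero_coordI)
    fix U \<phi> p assume c: "(U, \<phi>) \<in> charts S" "p \<in> U"
    obtain F where F: "F meromorphic_on {\<phi> p}" "\<forall>\<^sub>F z in at (\<phi> p). f (inv_into U \<phi> z) = Some (F z)"
      using local[OF c] by blast
    from F(2) have "\<forall>\<^sub>F z in at (\<phi> p). the (f (inv_into U \<phi> z)) = F z"
      by eventually_elim simp
    then show "(\<lambda>z. the (f (inv_into U \<phi> z))) meromorphic_on {\<phi> p}"
      using F(1) by (subst meromorphic_on_cong[where g = F and B = "{\<phi> p}"]) auto
  qed
qed

lemma meromorphic_function_extensional: "meromorphic_function S f \<Longrightarrow> f \<in> extensional carr"
  by (simp add: meromorphic_function_def)

text \<open>A meromorphic function takes at every point the limit of its own nearby values, and
  limits in the Hausdorff sphere are unique, so the description in \<open>extend\<close> recovers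
  \<open>f\<close>, also at its poles.\<close>

lemma extend_eqI:
  assumes f: "meromorphic_function S f" and u: "\<forall>\<^sub>F q in ae. the (f q) = u q"
  shows "extend S u = f"
proof
  fix p
  show "extend S u p = f p"
  proof (cases "p \<in> carr")
    case True
    have "\<forall>\<^sub>F q in ae. f q = Some (u q)"
      using meromorphic_function_finite[OF f] u by eventually_elim simp
    then have "\<forall>\<^sub>F q in atin (points S) p. f q = Some (u q)"
      using True by (simp add: eventually_codiscrete)
    then have "limitin riemann_sphere (\<lambda>q. Some (u q)) (f p) (atin (points S) p)"
      using meromorphic_function_limit[OF f True] by (rule limitin_transform_eventually)
    then have "(THE w. limitin riemann_sphere (\<lambda>q. Some (u q)) w (atin (points S) p)) = f p"
      using limitin_atin_unique[OF True] by (intro the_equality) auto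
    then show ?thesis using True by (simp add: extend_def)
  next
    case False
    then show ?thesis
      using meromorphic_function_extensional[OF f] by (auto simp: extend_def extensional_def)
  qed
qed

lemma extend_the: "meromorphic_function S f \<Longrightarrow> extend S (\<lambda>q. the (f q)) = f"
  by (rule extend_eqI) auto

lemma meromorphic_function_eqI:
  assumes "meromorphic_function S f" "meromorphic_function S g" "\<forall>\<^sub>F q in ae. the (f q) = the (g q)"
  shows "f = g"
  using extend_eqI[OF assms(1,3)] extend_the[OF assms(2)] by simp

text \<open>\<open>remove_sings\<close> corrects the arbitrary values of \<open>u\<close> at
  removable singularities; afterwards the limit in the sphere is either the value or, at a pole,
  infinity. This is the shape that \<open>meromorphic_function\<close> asks for.\<close>

lemma extend_chart:
  assumes u: "mero_coord S u" and c: "(U, \<phi>) \<in> charts S" "p \<in> U"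
  shows "extend S u p =
    (if is_pole (remove_sings (\<lambda>z. u (inv_into U \<phi> z))) (\<phi> p) then None
     else Some (remove_sings (\<lambda>z. u (inv_into U \<phi> z)) (\<phi> p)))" (is "_ = ?w")
proof -
  let ?u = "\<lambda>z. u (inv_into U \<phi> z)" and ?R = "remove_sings (\<lambda>z. u (inv_into U \<phi> z))"
  have p: "p \<in> carr" using c chartD(4) by blast
  have m: "?u meromorphic_on {\<phi> p}" by (rule mero_coord_at[OF u c])
  have sing: "isolated_singularity_at ?u (\<phi> p)"
    using m by (simp add: meromorphic_at_iff)
  have "?R nicely_meromorphic_on {\<phi> p}"
    using m by (rule remove_sings_nicely_meromorphic)
  then have "limitin riemann_sphere (\<lambda>z. Some (?R z)) ?w (at (\<phi> p))"
    unfolding nicely_meromorphic_on_def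
    by (auto simp: limitin_sphere_Some limitin_sphere_None is_pole_def)
  then have "limitin riemann_sphere (\<lambda>z. Some (?u z)) ?w (at (\<phi> p))"
    by (rule limitin_transform_eventually[rotated])
       (use eventually_remove_sings_eq_at[OF sing] in eventually_elim, simp)
  then have lim: "limitin riemann_sphere (\<lambda>q. Some (u q)) ?w (atin (points S) p)"
    by (simp only: atin_chart[OF c] limitin_filtermap)
  then have "(THE w. limitin riemann_sphere (\<lambda>q. Some (u q)) w (atin (points S) p)) = ?w"
    using limitin_atin_unique[OF p] by (intro the_equality) blast+
  then show ?thesis using p by (simp add: extend_def)
qed

lemma meromorphic_function_extend:
  assumes u: "mero_coord S u"
  shows "meromorphic_function S (extend S u)"
  unfolding meromorphic_function_def
proof (intro conjI ballI, goal_cases)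
  case 1
  then show ?case by (auto simp: extend_def)
next
  case (2 c)
  obtain U \<phi> where c: "c = (U, \<phi>)" by (cases c)
  have "remove_sings (\<lambda>z. u (inv_into U \<phi> z)) nicely_meromorphic_on \<phi> ` U"
    using u 2 by (intro remove_sings_nicely_meromorphic) (auto simp: mero_coord_def c)
  then show ?case using extend_chart[OF u] 2 unfolding c by blast
qed

lemma the_extend:
  assumes u: "mero_coord S u"
  shows "\<forall>\<^sub>F q in ae. the (extend S u q) = u q"
  unfolding eventually_codiscrete
proof
  fix p assume "p \<in> carr"
  then obtain U \<phi> where c: "(U, \<phi>) \<in> charts S" "p \<in> U" by (rule chart_exists)
  have "\<forall>\<^sub>F z in at (\<phi> p). (\<lambda>z. u (inv_into U \<phi> z)) analytic_on {z}"
    using mero_coord_at[OF u c] by (simp add: meromorphic_at_iff isolated_singularity_at_altdef)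
  moreover have "\<forall>\<^sub>F z in at (\<phi> p). z \<in> \<phi> ` U"
    using c chartD(2)[OF c(1)] by (intro eventually_at_in_open') auto
  ultimately have "\<forall>\<^sub>F z in at (\<phi> p). the (extend S u (inv_into U \<phi> z)) = u (inv_into U \<phi> z)"
  proof eventually_elim
    case (elim z)
    then obtain x where x: "x \<in> U" "z = \<phi> x" by blast
    have "\<not> is_pole (remove_sings (\<lambda>z. u (inv_into U \<phi> z))) z"
      using elim(1) by (simp add: analytic_at_imp_no_pole isolated_singularity_at_analytic)
    then show ?case
      using x elim(1) extend_chart[OF u c(1) x(1)] chartD(5)[OF c(1)] by simp
  qed
  then show "\<forall>\<^sub>F q in atin (points S) p. the (extend S u q) = u q"
    by (simp add: eventually_atin_chart[OF c])
qed

lemma extend_cong: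
  assumes "\<forall>\<^sub>F q in ae. u q = v q" "mero_coord S v"
  shows "extend S u = extend S v"
  by (rule extend_eqI[OF meromorphic_function_extend[OF assms(2)]])
     (use assms(1) the_extend[OF assms(2)] in eventually_elim, simp)

lemma const_fun_eq_extend: "const_fun S (Some c) = extend S (\<lambda>q. c)"
proof
  fix p
  have "limitin riemann_sphere (\<lambda>q. Some c) w (atin (points S) p) \<longleftrightarrow> w = Some c" if "p \<in> carr" for w
    using limitin_atin_unique[OF that, of "\<lambda>_. Some c" w "Some c"]
    by (auto simp: topspace_riemann_sphere)
  then show "const_fun S (Some c) p = extend S (\<lambda>q. c) p"
    by (simp add: const_fun_def extend_def)
qed

text \<open>Separates the degenerate value of the bijection from all its other values.\<close>

lemma not_meromorphic_const_None: "\<not> meromorphic_function S (const_fun S None)"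
proof
  assume "meromorphic_function S (const_fun S None)"
  then have "\<forall>\<^sub>F q in ae. const_fun S None q = Some (the (const_fun S None q))"
    by (rule meromorphic_function_finite)
  then have "\<forall>\<^sub>F q in ae. False"
    using eventually_codiscrete_in_surface by eventually_elim (simp add: const_fun_def)
  then show False using codiscrete_neq_bot by (simp add: trivial_limit_def)
qed

section \<open>Derivatives with respect to a meromorphic function\<close>

lemma eventually_nhdsin_chart:
  assumes c: "(U, \<phi>) \<in> charts S" "q \<in> U" and P: "eventually P (nhdsin (points S) q)"
  shows "\<forall>\<^sub>F z in nhds (\<phi> q). P (inv_into U \<phi> z)"
proof -
  have "P q" using P c chartD(4)[OF c(1)] by (auto simp: eventually_nhdsin)
  then have "P (inv_into U \<phi> (\<phi> q))" using c chartD(5)[OF c(1)] by simp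
  with eventually_nhdsin_imp_atin[OF P] show ?thesis
    unfolding eventually_atin_chart[OF c] by (simp add: eventually_nhds_conv_at)
qed

text \<open>\<open>T\<close> is the coordinate expression of \<open>A\<close>; an injective
  holomorphic function has nonzero derivative. The identity as \<open>A\<close> yields the change of
  charts.\<close>

lemma transition:
  assumes A: "holomorphic_self_map S A" "inj_on A carr"
    and c: "(U, \<phi>) \<in> charts S" "q \<in> U" and d: "(V, \<psi>) \<in> charts S" "A q \<in> V"
  obtains T where "T analytic_on {\<phi> q}" "T (\<phi> q) = \<psi> (A q)" "deriv T (\<phi> q) \<noteq> 0"
    "\<forall>\<^sub>F z in nhds (\<phi> q). inv_into V \<psi> (T z) = A (inv_into U \<phi> z)"
proof -
  let ?T = "\<psi> \<circ> A \<circ> inv_into U \<phi>" and ?W = "\<phi> ` (U \<inter> A -` V)"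
  have inj: "inj_on \<phi> U" "inj_on \<psi> V" using chartD c d by auto
  have "openin (points S) {x \<in> carr. A x \<in> V}"
    using A(1) chartD(1)[OF d(1)] openin_continuous_map_preimage
    unfolding holomorphic_self_map_def by blast
  then have "open (\<phi> ` (U \<inter> {x \<in> carr. A x \<in> V}))"
    by (rule chart_image_open[OF c(1)])
  moreover have "U \<inter> {x \<in> carr. A x \<in> V} = U \<inter> A -` V" using chartD(4)[OF c(1)] by auto
  ultimately have W: "open ?W" by simp
  have qW: "\<phi> q \<in> ?W" using c d by auto
  have T: "?T holomorphic_on ?W"
    using A(1) c(1) d(1) unfolding holomorphic_self_map_def by blast
  have Tx: "?T (\<phi> x) = \<psi> (A x)" if "x \<in> U" for x using that inj by simp
  have "inj_on ?T ?W"
  proof (rule inj_onI)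
    fix z w assume z: "z \<in> ?W" "w \<in> ?W" and eq: "?T z = ?T w"
    obtain x where x: "z = \<phi> x" "x \<in> U" "A x \<in> V" using z(1) by auto
    obtain y where y: "w = \<phi> y" "y \<in> U" "A y \<in> V" using z(2) by auto
    have "\<psi> (A x) = \<psi> (A y)" using eq unfolding x(1) y(1) Tx[OF x(2)] Tx[OF y(2)] .
    then have "A x = A y" using inj_onD[OF inj(2)] x y by blast
    then have "x = y" using inj_onD[OF A(2)] x y chartD(4)[OF c(1)] by blast
    then show "z = w" using x y by simp
  qed
  then have "deriv ?T (\<phi> q) \<noteq> 0"
    by (rule holomorphic_injective_imp_regular[OF T W _ qW])
  moreover have "?T analytic_on {\<phi> q}"
    using T W qW by (auto simp: analytic_at)
  moreover have "\<forall>\<^sub>F z in nhds (\<phi> q). inv_into V \<psi> (?T z) = A (inv_into U \<phi> z)"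
  proof (rule eventually_nhds_in_open[OF W qW, THEN eventually_mono])
    fix z assume "z \<in> ?W"
    then obtain x where x: "z = \<phi> x" "x \<in> U" "A x \<in> V" by auto
    then show "inv_into V \<psi> (?T z) = A (inv_into U \<phi> z)"
      using inj by simp
  qed
  ultimately show ?thesis using that[of ?T] Tx[OF c(2)] by blast
qed

text \<open>The factor \<open>t\<close>, the derivative of the transition map, is quantified before
  \<open>u\<close>: being common to all functions, it cancels from a quotient of two
  derivatives.\<close>

lemma analytic_compose_chart:
  assumes A: "holomorphic_self_map S A" "inj_on A carr"
    and c: "(U, \<phi>) \<in> charts S" "q \<in> U" and d: "(V, \<psi>) \<in> charts S" "A q \<in> V"
  shows "\<exists>t. t \<noteq> 0 \<and> (\<forall>u. (\<lambda>z. u (inv_into V \<psi> z)) analytic_on {\<psi> (A q)} \<longrightarrow>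
       (\<lambda>z. u (A (inv_into U \<phi> z))) analytic_on {\<phi> q} \<and>
       deriv (\<lambda>z. u (A (inv_into U \<phi> z))) (\<phi> q) = deriv (\<lambda>z. u (inv_into V \<psi> z)) (\<psi> (A q)) * t)"
proof -
  obtain T where T: "T analytic_on {\<phi> q}" "T (\<phi> q) = \<psi> (A q)" "deriv T (\<phi> q) \<noteq> 0"
    and ev: "\<forall>\<^sub>F z in nhds (\<phi> q). inv_into V \<psi> (T z) = A (inv_into U \<phi> z)"
    using transition[OF assms] by blast
  have "(\<lambda>z. u (A (inv_into U \<phi> z))) analytic_on {\<phi> q} \<and>
       deriv (\<lambda>z. u (A (inv_into U \<phi> z))) (\<phi> q) =
         deriv (\<lambda>z. u (inv_into V \<psi> z)) (\<psi> (A q)) * deriv T (\<phi> q)"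
    if u: "(\<lambda>z. u (inv_into V \<psi> z)) analytic_on {\<psi> (A q)}" for u :: "'a \<Rightarrow> complex"
  proof -
    let ?v = "\<lambda>z. u (inv_into V \<psi> z)"
    have ev: "\<forall>\<^sub>F z in nhds (\<phi> q). (?v \<circ> T) z = u (A (inv_into U \<phi> z))"
      using ev by eventually_elim simp
    have "?v \<circ> T analytic_on {\<phi> q}"
      using T u by (intro analytic_on_compose) auto
    moreover have "deriv (?v \<circ> T) (\<phi> q) = deriv ?v (T (\<phi> q)) * deriv T (\<phi> q)"
      using T u by (intro deriv_chain) (auto intro: analytic_on_imp_differentiable_at)
    ultimately show ?thesis
      using analytic_at_cong[OF ev refl] deriv_cong_ev[OF ev refl] T(2) by simp
  qed
  with T(3) show ?thesis by blast
qed

lemma holomorphic_self_map_id: "holomorphic_self_map S (\<lambda>x. x)"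
proof -
  have "\<forall>(U, \<phi>)\<in>charts S. \<forall>(V, \<psi>)\<in>charts S. (\<psi> \<circ> inv_into U \<phi>) holomorphic_on \<phi> ` (U \<inter> V)"
    using riemann_surface unfolding riemann_surface_def by blast
  then show ?thesis
    unfolding holomorphic_self_map_def by (auto simp: comp_def)
qed

lemmas analytic_change_chart =
  analytic_compose_chart[OF holomorphic_self_map_id inj_on_id2]

lemma analytic_at_pointI:
  assumes d: "(V, \<psi>) \<in> charts S" "q \<in> V" and u: "(\<lambda>z. u (inv_into V \<psi> z)) analytic_on {\<psi> q}"
  shows "analytic_at_point S u q"
  unfolding analytic_at_point_def
proof (clarify)
  fix U \<phi> assume c: "(U, \<phi>) \<in> charts S" "q \<in> U"
  show "(\<lambda>z. u (inv_into U \<phi> z)) analytic_on {\<phi> q}"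
    using analytic_change_chart[OF c d] u by (elim exE conjE allE[of _ u]) simp
qed

lemma analytic_at_pointD:
  assumes "analytic_at_point S u q" "(U, \<phi>) \<in> charts S" "q \<in> U"
  shows "(\<lambda>z. u (inv_into U \<phi> z)) analytic_on {\<phi> q}"
  using assms by (auto simp: analytic_at_point_def)

lemma mero_coord_imp_analytic:
  assumes u: "mero_coord S u"
  shows "\<forall>\<^sub>F q in ae. analytic_at_point S u q"
  unfolding eventually_codiscrete
proof
  fix p assume "p \<in> carr"
  then obtain U \<phi> where c: "(U, \<phi>) \<in> charts S" "p \<in> U" by (rule chart_exists)
  have "\<forall>\<^sub>F z in at (\<phi> p). (\<lambda>z. u (inv_into U \<phi> z)) analytic_on {z}"
    using mero_coord_at[OF u c] by (simp add: meromorphic_at_iff isolated_singularity_at_altdef)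
  moreover have "\<forall>\<^sub>F z in at (\<phi> p). z \<in> \<phi> ` U"
    using c chartD(2)[OF c(1)] by (intro eventually_at_in_open') auto
  ultimately show "\<forall>\<^sub>F q in atin (points S) p. analytic_at_point S u q"
    unfolding eventually_atin_chart[OF c]
  proof eventually_elim
    case (elim z)
    then obtain x where x: "x \<in> U" "z = \<phi> x" by blast
    then show ?case
      using elim(1) chartD(5)[OF c(1)] analytic_at_pointI[OF c(1) x(1), of u] by simp
  qed
qed

lemma chart_at:
  assumes "q \<in> carr" "chart_at S q = (U, \<phi>)"
  shows "(U, \<phi>) \<in> charts S" "q \<in> U"
proof -
  have "\<exists>c. c \<in> charts S \<and> q \<in> fst c" using assms(1) by (metis chart_exists fst_conv)
  then have "chart_at S q \<in> charts S \<and> q \<in> fst (chart_at S q)"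
    unfolding chart_at_def by (rule someI_ex)
  then show "(U, \<phi>) \<in> charts S" "q \<in> U" using assms(2) by auto
qed

text \<open>Numerator and denominator acquire the same nonzero factor. The chart at \<open>q\<close>
  is arbitrary whereas \<open>deriv_quot\<close> selects its own at \<open>A q\<close>, so one
  statement covers both independence of the chart, with the identity as \<open>A\<close>, and
  compatibility with automorphisms.\<close>

lemma deriv_quot_compose:
  assumes A: "holomorphic_self_map S A" "inj_on A carr"
    and q: "q \<in> carr" "A q \<in> carr"
    and u: "analytic_at_point S u (A q)" and g: "analytic_at_point S g (A q)"
    and c: "(U, \<phi>) \<in> charts S" "q \<in> U"
  shows "deriv (\<lambda>z. u (A (inv_into U \<phi> z))) (\<phi> q) / deriv (\<lambda>z. g (A (inv_into U \<phi> z))) (\<phi> q)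
    = deriv_quot S u g (A q)"
proof -
  obtain V \<psi> where V: "chart_at S (A q) = (V, \<psi>)" by fastforce
  have d: "(V, \<psi>) \<in> charts S" "A q \<in> V" using chart_at[OF q(2) V] .
  obtain t where "t \<noteq> 0" and
    t: "\<forall>u. (\<lambda>z. u (inv_into V \<psi> z)) analytic_on {\<psi> (A q)} \<longrightarrow>
       (\<lambda>z. u (A (inv_into U \<phi> z))) analytic_on {\<phi> q} \<and>
       deriv (\<lambda>z. u (A (inv_into U \<phi> z))) (\<phi> q) = deriv (\<lambda>z. u (inv_into V \<psi> z)) (\<psi> (A q)) * t"
    using analytic_compose_chart[OF A c d] by (elim exE conjE)
  then show ?thesis
    using t[rule_format, OF analytic_at_pointD[OF u d]] t[rule_format, OF analytic_at_pointD[OF g d]]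
    by (simp add: V deriv_quot_def)
qed

lemma deriv_quot_chart:
  assumes "(U, \<phi>) \<in> charts S" "q \<in> U" "analytic_at_point S u q" "analytic_at_point S g q"
  shows "deriv_quot S u g q =
    deriv (\<lambda>z. u (inv_into U \<phi> z)) (\<phi> q) / deriv (\<lambda>z. g (inv_into U \<phi> z)) (\<phi> q)"
  using deriv_quot_compose[OF holomorphic_self_map_id inj_on_id2 _ _ assms(3,4,1,2)]
    assms(2) chartD(4)[OF assms(1)] by auto

lemma deriv_quot_pullback:
  assumes A: "holomorphic_self_map S A" "inj_on A carr"
    and q: "q \<in> carr" "A q \<in> carr"
    and u: "analytic_at_point S u (A q)" and g: "analytic_at_point S g (A q)"
  shows "deriv_quot S (\<lambda>x. u (A x)) (\<lambda>x. g (A x)) q = deriv_quot S u g (A q)"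
proof -
  obtain U \<phi> where U: "chart_at S q = (U, \<phi>)" by fastforce
  show ?thesis
    using deriv_quot_compose[OF A q u g chart_at[OF q(1) U]] by (simp add: deriv_quot_def U)
qed

lemma deriv_quot_cong:
  assumes "\<forall>\<^sub>F q in ae. u q = u' q" "\<forall>\<^sub>F q in ae. g q = g' q"
  shows "\<forall>\<^sub>F q in ae. deriv_quot S u g q = deriv_quot S u' g' q"
  using eventually_eventually_codiscrete[OF assms(1)] eventually_eventually_codiscrete[OF assms(2)]
    eventually_codiscrete_in_surface
proof eventually_elim
  case (elim q)
  obtain U \<phi> where U: "chart_at S q = (U, \<phi>)" by fastforce
  note c = chart_at[OF elim(3) U]
  show ?case
    using deriv_cong_ev[OF eventually_nhdsin_chart[OF c elim(1)] refl]
      deriv_cong_ev[OF eventually_nhdsin_chart[OF c elim(2)] refl]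
    by (simp add: deriv_quot_def U)
qed

text \<open>\<open>chart_at\<close> may jump from point to point. Near \<open>p\<close> a single
  chart can replace it, at all points where both functions are analytic.\<close>

lemma eventually_deriv_quot_chart:
  assumes u: "mero_coord S u" and g: "mero_coord S g" and c: "(U, \<phi>) \<in> charts S" "p \<in> U"
  shows "\<forall>\<^sub>F q in atin (points S) p. q \<in> U \<and> deriv_quot S u g q =
    deriv (\<lambda>z. u (inv_into U \<phi> z)) (\<phi> q) / deriv (\<lambda>z. g (inv_into U \<phi> z)) (\<phi> q)"
proof -
  have p: "p \<in> carr" using c chartD(4) by blast
  have "\<forall>\<^sub>F q in atin (points S) p. q \<in> U"
    using c chartD(1) by (auto simp: eventually_atin)
  moreover have "\<forall>\<^sub>F q in atin (points S) p. analytic_at_point S u q"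
    "\<forall>\<^sub>F q in atin (points S) p. analytic_at_point S g q"
    using mero_coord_imp_analytic[OF u] mero_coord_imp_analytic[OF g] p
    by (auto simp: eventually_codiscrete)
  ultimately show ?thesis
    by eventually_elim (use deriv_quot_chart[OF c(1)] in blast)
qed

lemma mero_coord_deriv_quot:
  assumes u: "mero_coord S u" and g: "mero_coord S g"
  shows "mero_coord S (deriv_quot S u g)"
proof (rule mero_coordI)
  fix U \<phi> p assume c: "(U, \<phi>) \<in> charts S" "p \<in> U"
  let ?D = "\<lambda>z. deriv (\<lambda>z. u (inv_into U \<phi> z)) z / deriv (\<lambda>z. g (inv_into U \<phi> z)) z"
  have "\<forall>\<^sub>F z in at (\<phi> p). z \<in> \<phi> ` U"
    using c chartD(2)[OF c(1)] by (intro eventually_at_in_open') auto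
  with eventually_deriv_quot_chart[OF assms c]
  have "\<forall>\<^sub>F z in at (\<phi> p). deriv_quot S u g (inv_into U \<phi> z) = ?D z"
    unfolding eventually_atin_chart[OF c]
    by eventually_elim (auto simp: f_inv_into_f)
  moreover have "?D meromorphic_on {\<phi> p}"
    using mero_coord_at[OF u c] mero_coord_at[OF g c] by (intro meromorphic_intros)
  ultimately show "(\<lambda>z. deriv_quot S u g (inv_into U \<phi> z)) meromorphic_on {\<phi> p}"
    by (subst meromorphic_on_cong[where g = ?D and B = "{\<phi> p}"]) auto
qed

lemma diff_quot_eq_extend:
  assumes f: "meromorphic_function S f" and g: "meromorphic_function S g"
  shows "diff_quot S f g = extend S (deriv_quot S (\<lambda>q. the (f q)) (\<lambda>q. the (g q)))"
proof
  fix p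
  let ?D = "deriv_quot S (\<lambda>q. the (f q)) (\<lambda>q. the (g q))"
  show "diff_quot S f g p = extend S ?D p"
  proof (cases "p \<in> carr")
    case True
    have lim: "limitin riemann_sphere (\<lambda>q. Some (chart_deriv U \<phi> f q / chart_deriv U \<phi> g q)) w
          (atin (points S) p) \<longleftrightarrow>
        limitin riemann_sphere (\<lambda>q. Some (?D q)) w (atin (points S) p)"
      if c: "(U, \<phi>) \<in> charts S" "p \<in> U" for U \<phi> w
    proof -
      have 1: "\<forall>\<^sub>F q in atin (points S) p.
          Some (?D q) = Some (chart_deriv U \<phi> f q / chart_deriv U \<phi> g q)"
        using eventually_deriv_quot_chart[OF mero_coord_the[OF f] mero_coord_the[OF g] c]
        by eventually_elim (simp add: chart_deriv_def)
      then have 2: "\<forall>\<^sub>F q in atin (points S) p.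
          Some (chart_deriv U \<phi> f q / chart_deriv U \<phi> g q) = Some (?D q)"
        by eventually_elim simp
      show ?thesis
        using limitin_transform_eventually[OF 1] limitin_transform_eventually[OF 2] by blast
    qed
    \<comment> \<open>At least one chart contains \<open>p\<close>, so the condition over all charts
      in \<open>diff_quot\<close> is not vacuous; by \<open>lim\<close> each chart imposes the same
      condition.\<close>
    obtain U \<phi> where "(U, \<phi>) \<in> charts S" "p \<in> U" using True by (rule chart_exists)
    then have "(\<forall>(U, \<phi>)\<in>charts S. p \<in> U \<longrightarrow>
        limitin riemann_sphere (\<lambda>q. Some (chart_deriv U \<phi> f q / chart_deriv U \<phi> g q)) w
          (atin (points S) p)) \<longleftrightarrow>
        limitin riemann_sphere (\<lambda>q. Some (?D q)) w (atin (points S) p)" for w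
      using lim by blast
    then show ?thesis using True by (simp add: diff_quot_def extend_def)
  qed (simp add: diff_quot_def extend_def)
qed

text \<open>Otherwise the derivative vanishes near \<open>\<phi> p\<close> and \<open>u\<close>
  equals some \<open>k\<close> on a punctured disc, which is connected; the identity theorem for
  \<open>u - k\<close> then makes \<open>u\<close> constant off a discrete set of the whole
  surface.\<close>

lemma deriv_eventually_nonzero:
  assumes u: "mero_coord S u" and nc: "\<nexists>k. \<forall>\<^sub>F q in ae. u q = k"
    and c: "(U, \<phi>) \<in> charts S" "p \<in> U"
  shows "\<forall>\<^sub>F z in at (\<phi> p). deriv (\<lambda>z. u (inv_into U \<phi> z)) z \<noteq> 0"
proof (rule ccontr)
  let ?u = "\<lambda>z. u (inv_into U \<phi> z)"
  assume *: "\<not> ?thesis"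
  have m: "?u meromorphic_on {\<phi> p}" by (rule mero_coord_at[OF u c])
  have "\<forall>\<^sub>F z in at (\<phi> p). deriv ?u z = 0"
    using meromorphic_eventually_zero_or_nonzero[OF meromorphic_on_deriv[OF m]] * by simp
  moreover have "\<forall>\<^sub>F z in at (\<phi> p). ?u analytic_on {z}"
    using m by (simp add: meromorphic_at_iff isolated_singularity_at_altdef)
  ultimately have "\<forall>\<^sub>F z in at (\<phi> p). (?u has_field_derivative 0) (at z)"
  proof eventually_elim
    case (elim z)
    then show ?case using analytic_derivI[OF elim(2)] by simp
  qed
  then obtain r where r: "r > 0" "\<And>z. z \<in> ball (\<phi> p) r - {\<phi> p} \<Longrightarrow> (?u has_field_derivative 0) (at z)"
    unfolding eventually_at by (auto simp: dist_commute[of "\<phi> p"])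
  let ?B = "ball (\<phi> p) r - {\<phi> p}"
  have "connected ?B" by (intro connected_punctured_ball) simp
  moreover have "open ?B" by (intro open_delete) simp
  moreover have "continuous_on ?B ?u"
    by (rule continuous_at_imp_continuous_on) (rule ballI, rule DERIV_isCont, erule r(2))
  moreover have "\<forall>z\<in>?B - {}. (?u has_field_derivative 0) (at z)" using r(2) by simp
  ultimately have "?u constant_on ?B"
    using DERIV_zero_connected_constant_on[of ?B "{}" ?u] by simp
  then obtain k where k: "\<And>z. z \<in> ?B \<Longrightarrow> ?u z = k" by (auto simp: constant_on_def)
  have "\<forall>\<^sub>F z in at (\<phi> p). ?u z = k"
    unfolding eventually_at by (rule exI[of _ r]) (use k r in \<open>auto simp: dist_commute[of "\<phi> p"]\<close>)
  then have "\<forall>\<^sub>F q in atin (points S) p. u q - k = 0"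
    by (simp add: eventually_atin_chart[OF c])
  moreover have p: "p \<in> carr" using c chartD(4) by blast
  have "\<not> (\<forall>\<^sub>F q in ae. u q - k = 0)" using nc by auto
  then have "\<forall>\<^sub>F q in ae. u q - k \<noteq> 0"
    using mero_coord_zero_or_nonzero[OF mero_coord_intros(3)[OF u mero_coord_intros(1)[of k]]] by simp
  then have "\<forall>\<^sub>F q in atin (points S) p. u q - k \<noteq> 0"
    using p by (simp add: eventually_codiscrete)
  ultimately have "\<forall>\<^sub>F q in atin (points S) p. False"
    by eventually_elim simp
  then show False using atin_neq_bot[OF p] by (simp add: trivial_limit_def)
qed

lemma deriv_quot_eventually_nonzero:
  assumes u: "mero_coord S u" "\<nexists>k. \<forall>\<^sub>F q in ae. u q = k"
    and g: "mero_coord S g" "\<nexists>k. \<forall>\<^sub>F q in ae. g q = k"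
  shows "\<forall>\<^sub>F q in ae. deriv_quot S u g q \<noteq> 0"
  unfolding eventually_codiscrete
proof
  fix p assume "p \<in> carr"
  then obtain U \<phi> where c: "(U, \<phi>) \<in> charts S" "p \<in> U" by (rule chart_exists)
  have "\<forall>\<^sub>F z in at (\<phi> p). z \<in> \<phi> ` U"
    using c chartD(2)[OF c(1)] by (intro eventually_at_in_open') auto
  with eventually_deriv_quot_chart[OF u(1) g(1) c] deriv_eventually_nonzero[OF u c]
    deriv_eventually_nonzero[OF g c]
  show "\<forall>\<^sub>F q in atin (points S) p. deriv_quot S u g q \<noteq> 0"
    unfolding eventually_atin_chart[OF c] by eventually_elim (auto simp: f_inv_into_f)
qed

section \<open>Quotient rules for Moebius expressions\<close>

lemma deriv_quot_moebius:
  assumes q: "q \<in> carr" and u: "analytic_at_point S u q" and nz: "c * u q + d \<noteq> 0"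
  shows "deriv_quot S (\<lambda>x. (a * u x + b) / (c * u x + d)) g q =
    (a * d - b * c) * deriv_quot S u g q / (c * u q + d)^2"
proof -
  obtain U \<phi> where U: "chart_at S q = (U, \<phi>)" by fastforce
  note ch = chart_at[OF q U]
  let ?u' = "deriv (\<lambda>z. u (inv_into U \<phi> z)) (\<phi> q)"
  have uq: "u (inv_into U \<phi> (\<phi> q)) = u q" using ch chartD(5)[OF ch(1)] by simp
  have 1: "((\<lambda>z. u (inv_into U \<phi> z)) has_field_derivative ?u') (at (\<phi> q))"
    by (rule analytic_derivI[OF analytic_at_pointD[OF u ch]])
  have "((\<lambda>z. (a * u (inv_into U \<phi> z) + b) / (c * u (inv_into U \<phi> z) + d)) has_field_derivative
      (a * ?u' * (c * u q + d) - (a * u q + b) * (c * ?u')) / ((c * u q + d) * (c * u q + d))) (at (\<phi> q))"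
    using nz by (auto intro!: derivative_eq_intros 1 simp: uq)
  moreover have "a * ?u' * (c * u q + d) - (a * u q + b) * (c * ?u') = (a * d - b * c) * ?u'"
    by (simp add: algebra_simps)
  ultimately have "deriv (\<lambda>z. (a * u (inv_into U \<phi> z) + b) / (c * u (inv_into U \<phi> z) + d)) (\<phi> q) =
      (a * d - b * c) * ?u' / (c * u q + d)^2"
    by (simp add: DERIV_imp_deriv power2_eq_square)
  then show ?thesis by (simp add: deriv_quot_def U)
qed

text \<open>For \<open>v\<close> the derivative of \<open>u\<close> and \<open>e\<close> the
  determinant, the function differentiated here is the derivative of the Moebius transform of
  \<open>u\<close>; this supplies the second derivative.\<close>

lemma deriv_quot_weighted:
  assumes q: "q \<in> carr" and u: "analytic_at_point S u q" and v: "analytic_at_point S v q"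
    and nz: "c * u q + d \<noteq> 0"
  shows "deriv_quot S (\<lambda>x. e * v x / (c * u x + d)^2) g q =
    e * (deriv_quot S v g q * (c * u q + d) - 2 * c * v q * deriv_quot S u g q) / (c * u q + d)^3"
proof -
  obtain U \<phi> where U: "chart_at S q = (U, \<phi>)" by fastforce
  note ch = chart_at[OF q U]
  let ?u' = "deriv (\<lambda>z. u (inv_into U \<phi> z)) (\<phi> q)" and ?v' = "deriv (\<lambda>z. v (inv_into U \<phi> z)) (\<phi> q)"
  have uq: "u (inv_into U \<phi> (\<phi> q)) = u q" "v (inv_into U \<phi> (\<phi> q)) = v q"
    using ch chartD(5)[OF ch(1)] by simp_all
  have 1: "((\<lambda>z. u (inv_into U \<phi> z)) has_field_derivative ?u') (at (\<phi> q))"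
    "((\<lambda>z. v (inv_into U \<phi> z)) has_field_derivative ?v') (at (\<phi> q))"
    by (rule analytic_derivI[OF analytic_at_pointD[OF _ ch]], fact)+
  have D: "((\<lambda>z. e * v (inv_into U \<phi> z) / (c * u (inv_into U \<phi> z) + d)^2) has_field_derivative
      (e * ?v' * (c * u q + d)^2 - e * v q * (2 * (c * u q + d) * (c * ?u'))) /
        ((c * u q + d)^2 * (c * u q + d)^2)) (at (\<phi> q))"
    using nz by (auto intro!: derivative_eq_intros 1 simp: uq)
  have alg: "(e * y * w^2 - e * r * (2 * w * (c * x))) / (w^2 * w^2) =
      e * (y * w - 2 * c * r * x) / w^3" if "w \<noteq> 0" for w x y r :: complex
    using that by (simp add: divide_simps) (simp add: algebra_simps eval_nat_numeral)
  have "deriv (\<lambda>z. e * v (inv_into U \<phi> z) / (c * u (inv_into U \<phi> z) + d)^2) (\<phi> q) =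
      e * (?v' * (c * u q + d) - 2 * c * v q * ?u') / (c * u q + d)^3"
    unfolding DERIV_imp_deriv[OF D] by (rule alg[OF nz])
  \<comment> \<open>\<open>t\<close> is the derivative of \<open>g\<close> in the chart. If it
    vanishes, both sides are 0, because division by zero gives 0.\<close>
  moreover have "e * (x * w - 2 * c * r * y) / w^3 / t = e * (x / t * w - 2 * c * r * (y / t)) / w^3"
    for x w r y t :: complex
    by (cases "t = 0") (simp_all add: field_simps)
  ultimately show ?thesis by (simp add: deriv_quot_def U)
qed

section \<open>Equivariance off a discrete set\<close>

lemma AutD:
  assumes "A \<in> carrier (Aut S)"
  shows "holomorphic_self_map S A" "inj_on A carr" "\<And>p. p \<in> carr \<Longrightarrow> A p \<in> carr"
  using assms by (auto simp: Aut_def Bij_def bij_betw_def)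

text \<open>Continuity of \<open>A\<close> pulls back neighbourhoods, and injectivity ensures that
  no point other than \<open>p\<close> lands on the excluded point \<open>A p\<close>.\<close>

lemma eventually_atin_pullback:
  assumes A: "A \<in> carrier (Aut S)" and p: "p \<in> carr" and P: "eventually P (atin (points S) (A p))"
  shows "\<forall>\<^sub>F q in atin (points S) p. P (A q)"
proof -
  obtain V where V: "openin (points S) V" "A p \<in> V" "\<forall>x\<in>V - {A p}. P x"
    using P AutD(3)[OF A p] by (auto simp: eventually_atin)
  have "openin (points S) {x \<in> carr. A x \<in> V}"
    using AutD(1)[OF A] V(1) openin_continuous_map_preimage
    unfolding holomorphic_self_map_def by blast
  moreover have "P (A x)" if "x \<in> {x \<in> carr. A x \<in> V} - {p}" for x
    using that V(3) p inj_onD[OF AutD(2)[OF A], of x p] by blast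
  ultimately show ?thesis
    unfolding eventually_atin using p V(2)
    by (intro disjI2 exI[of _ "{x \<in> carr. A x \<in> V}"]) auto
qed

lemma eventually_codiscrete_pullback:
  assumes "A \<in> carrier (Aut S)" "eventually P ae"
  shows "\<forall>\<^sub>F q in ae. P (A q)"
  unfolding eventually_codiscrete
proof
  fix p assume p: "p \<in> carr"
  then have "eventually P (atin (points S) (A p))"
    using assms(2) AutD(3)[OF assms(1) p] by (simp add: eventually_codiscrete)
  then show "\<forall>\<^sub>F q in atin (points S) p. P (A q)"
    by (rule eventually_atin_pullback[OF assms(1) p])
qed

text \<open>From left to right, \<open>f q\<close> and \<open>f (A q)\<close> are both finite off a
  discrete set, which excludes the infinite branches of \<open>moebius_map\<close>. Conversely,
  \<open>moebius_map M (f p)\<close> and \<open>f (A p)\<close> are limits of the same function at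
  \<open>p\<close>, the first by continuity of the Moebius map, the second by continuity of
  \<open>f\<close> and \<open>A\<close>.\<close>

lemma moebius_equivariant_iff:
  fixes M :: "complex^2^2"
  assumes f: "meromorphic_function S f" and A: "A \<in> carrier (Aut S)"
    and det: "M$1$1 * M$2$2 \<noteq> M$1$2 * M$2$1"
  shows "(\<forall>p\<in>carr. f (A p) = moebius_map M (f p)) \<longleftrightarrow>
    (\<forall>\<^sub>F q in ae. M$2$1 * the (f q) + M$2$2 \<noteq> 0 \<and>
       the (f (A q)) = (M$1$1 * the (f q) + M$1$2) / (M$2$1 * the (f q) + M$2$2))"
    (is "_ \<longleftrightarrow> eventually ?P ae")
proof
  note fin = meromorphic_function_finite[OF f]
  note finA = eventually_codiscrete_pullback[OF A fin]
  {
    assume eq: "\<forall>p\<in>carr. f (A p) = moebius_map M (f p)"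
    show "eventually ?P ae"
      using fin finA eventually_codiscrete_in_surface
    proof eventually_elim
      case (elim q)
      have "moebius_map M (f q) = f (A q)" by (rule eq[rule_format, OF elim(3), symmetric])
      then have "moebius_map M (Some (the (f q))) = Some (the (f (A q)))"
        by (simp only: elim(1,2)[symmetric])
      then show ?case by (auto simp: moebius_def split: if_splits)
    qed
  next
    assume ev: "eventually ?P ae"
    show "\<forall>p\<in>carr. f (A p) = moebius_map M (f p)"
    proof
      fix p assume p: "p \<in> carr"
      have lim: "limitin riemann_sphere (\<lambda>q. Some (the (f q))) (f p) (atin (points S) p)"
      proof (rule limitin_transform_eventually[OF _ meromorphic_function_limit[OF f p]])
        show "\<forall>\<^sub>F q in atin (points S) p. f q = Some (the (f q))"
          using fin p unfolding eventually_codiscrete by blast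
      qed
      have "\<forall>\<^sub>F q in ae. moebius_map M (Some (the (f q))) = Some (the (f (A q)))"
        using ev by eventually_elim (simp add: moebius_def)
      then have "limitin riemann_sphere (\<lambda>q. Some (the (f (A q)))) (moebius_map M (f p)) (atin (points S) p)"
        using p by (intro limitin_sphere_moebius[OF det lim]) (simp add: eventually_codiscrete)
      moreover have "limitin riemann_sphere (\<lambda>q. f (A q)) (f (A p)) (atin (points S) p)"
        unfolding limitin_def
      proof (intro conjI allI impI)
        show "f (A p) \<in> topspace riemann_sphere" by (simp add: topspace_riemann_sphere)
        fix W assume "openin riemann_sphere W \<and> f (A p) \<in> W"
        then have "\<forall>\<^sub>F q in atin (points S) (A p). f q \<in> W"
          using meromorphic_function_limit[OF f AutD(3)[OF A p]] by (simp add: limitin_def)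
        then show "\<forall>\<^sub>F q in atin (points S) p. f (A q) \<in> W"
          by (rule eventually_atin_pullback[OF A p])
      qed
      then have "limitin riemann_sphere (\<lambda>q. Some (the (f (A q)))) (f (A p)) (atin (points S) p)"
      proof (rule limitin_transform_eventually[rotated])
        show "\<forall>\<^sub>F q in atin (points S) p. f (A q) = Some (the (f (A q)))"
          using finA p unfolding eventually_codiscrete by blast
      qed
      ultimately show "f (A p) = moebius_map M (f p)"
        using limitin_atin_unique[OF p] by blast
    qed
  }
qed

lemma invariant_iff:
  assumes f: "meromorphic_function S f" and A: "A \<in> carrier (Aut S)"
  shows "(\<forall>p\<in>carr. f (A p) = f p) \<longleftrightarrow> (\<forall>\<^sub>F q in ae. the (f (A q)) = the (f q))"
proof -
  have "moebius_map (mat 1) w = w" for w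
    by (cases w) (auto simp: mat_def moebius_def)
  then show ?thesis
    using moebius_equivariant_iff[OF f A, of "mat 1"] by (simp add: mat_def)
qed

section \<open>Computing in the field of meromorphic functions\<close>

text \<open>A relation, since many finite-valued functions stand for the same \<open>f\<close>:
  pointwise sums, products and quotients of representatives can be used as they are, without
  correcting values at poles.\<close>

definition repr :: "('a \<Rightarrow> complex option) \<Rightarrow> ('a \<Rightarrow> complex) \<Rightarrow> bool" where
  "repr f u \<longleftrightarrow> meromorphic_function S f \<and> (\<forall>\<^sub>F q in ae. the (f q) = u q)"

lemma repr_the: "meromorphic_function S f \<Longrightarrow> repr f (\<lambda>q. the (f q))"
  by (simp add: repr_def)

lemma repr_mero_coord: "repr f u \<Longrightarrow> mero_coord S u"
  unfolding repr_def by (elim conjE) (rule mero_coord_cong[THEN iffD1, OF _ mero_coord_the])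

lemma repr_extend: "mero_coord S u \<Longrightarrow> repr (extend S u) u"
  by (simp add: repr_def meromorphic_function_extend the_extend)

lemma repr_eq_iff:
  assumes "repr f u" "repr g v"
  shows "f = g \<longleftrightarrow> (\<forall>\<^sub>F q in ae. u q = v q)"
proof
  assume "f = g"
  with assms have "\<forall>\<^sub>F q in ae. the (f q) = u q" "\<forall>\<^sub>F q in ae. the (f q) = v q"
    by (auto simp: repr_def)
  then show "\<forall>\<^sub>F q in ae. u q = v q" by eventually_elim simp
next
  assume ev: "\<forall>\<^sub>F q in ae. u q = v q"
  have "\<forall>\<^sub>F q in ae. the (f q) = u q" "\<forall>\<^sub>F q in ae. the (g q) = v q"
    using assms by (auto simp: repr_def)
  with ev have "\<forall>\<^sub>F q in ae. the (f q) = the (g q)" by eventually_elim simp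
  then show "f = g" using assms by (auto simp: repr_def intro: meromorphic_function_eqI)
qed

lemma repr_const: "repr (const_fun S (Some c)) (\<lambda>q. c)"
  unfolding const_fun_eq_extend by (intro repr_extend mero_coord_intros)

lemma repr_add:
  assumes "repr f u" "repr g v"
  shows "repr (f \<oplus>\<^bsub>mero_field S\<^esub> g) (\<lambda>q. u q + v q)"
proof -
  have "\<forall>\<^sub>F q in ae. the (f q) = u q" "\<forall>\<^sub>F q in ae. the (g q) = v q"
    using assms by (auto simp: repr_def)
  then have "\<forall>\<^sub>F q in ae. the (f q) + the (g q) = u q + v q" by eventually_elim simp
  then have "f \<oplus>\<^bsub>mero_field S\<^esub> g = extend S (\<lambda>q. u q + v q)"
    using assms unfolding mero_field_def
    by (simp add: extend_cong mero_coord_intros repr_mero_coord)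
  then show ?thesis
    using assms by (simp add: repr_extend mero_coord_intros repr_mero_coord)
qed

lemma repr_mult:
  assumes "repr f u" "repr g v"
  shows "repr (f \<otimes>\<^bsub>mero_field S\<^esub> g) (\<lambda>q. u q * v q)"
proof -
  have "\<forall>\<^sub>F q in ae. the (f q) = u q" "\<forall>\<^sub>F q in ae. the (g q) = v q"
    using assms by (auto simp: repr_def)
  then have "\<forall>\<^sub>F q in ae. the (f q) * the (g q) = u q * v q" by eventually_elim simp
  then have "f \<otimes>\<^bsub>mero_field S\<^esub> g = extend S (\<lambda>q. u q * v q)"
    using assms unfolding mero_field_def
    by (simp add: extend_cong mero_coord_intros repr_mero_coord)
  then show ?thesis
    using assms by (simp add: repr_extend mero_coord_intros repr_mero_coord)
qed

lemma repr_zero: "repr \<zero>\<^bsub>mero_field S\<^esub> (\<lambda>q. 0)"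
  using repr_const[of 0] by (simp add: mero_field_def)

lemma repr_one: "repr \<one>\<^bsub>mero_field S\<^esub> (\<lambda>q. 1)"
  using repr_const[of 1] by (simp add: mero_field_def)

lemma repr_carrier: "repr f u \<Longrightarrow> f \<in> carrier (mero_field S)"
  by (simp add: mero_field_def repr_def)

lemma repr_carrierE:
  assumes "f \<in> carrier (mero_field S)"
  obtains u where "repr f u"
  using assms repr_the by (auto simp: mero_field_def)

text \<open>The additive inverse is a definite description over the carrier, so existence and
  uniqueness are both checked on representatives; \<open>repr_inv\<close> proceeds likewise for the
  multiplicative inverse.\<close>

lemma repr_uminus:
  assumes f: "repr f u"
  shows "repr (\<ominus>\<^bsub>mero_field S\<^esub> f) (\<lambda>q. - u q)"
proof -
  let ?R = "mero_field S" and ?g = "extend S (\<lambda>q. - u q)"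
  have g: "repr ?g (\<lambda>q. - u q)"
    using f by (intro repr_extend mero_coord_intros repr_mero_coord)
  have "\<ominus>\<^bsub>?R\<^esub> f = ?g"
    unfolding a_inv_def m_inv_def
  proof (rule the_equality, goal_cases)
    case 1
    show ?case
      using repr_carrier[OF g] repr_eq_iff[OF repr_add[OF f g] repr_zero]
        repr_eq_iff[OF repr_add[OF g f] repr_zero] by simp
  next
    case (2 y)
    then obtain v where y: "repr y v" by (auto elim: repr_carrierE)
    have "\<forall>\<^sub>F q in ae. u q + v q = 0"
      using 2 repr_eq_iff[OF repr_add[OF f y] repr_zero] by simp
    then have "\<forall>\<^sub>F q in ae. v q = - u q"
      by eventually_elim (simp add: add_eq_0_iff)
    then show ?case using repr_eq_iff[OF y g] by simp
  qed
  with g show ?thesis by simp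
qed

lemma repr_minus:
  assumes "repr f u" "repr g v"
  shows "repr (f \<ominus>\<^bsub>mero_field S\<^esub> g) (\<lambda>q. u q - v q)"
  using repr_add[OF assms(1) repr_uminus[OF assms(2)]] by (simp add: a_minus_def)

lemma repr_inv:
  assumes f: "repr f u" and nz: "\<forall>\<^sub>F q in ae. u q \<noteq> 0"
  shows "repr (inv\<^bsub>mero_field S\<^esub> f) (\<lambda>q. 1 / u q)"
proof -
  let ?R = "mero_field S" and ?g = "extend S (\<lambda>q. 1 / u q)"
  have g: "repr ?g (\<lambda>q. 1 / u q)"
    using f by (intro repr_extend mero_coord_intros repr_mero_coord)
  have "inv\<^bsub>?R\<^esub> f = ?g"
    unfolding m_inv_def
  proof (rule the_equality, goal_cases)
    case 1
    have "\<forall>\<^sub>F q in ae. u q * (1 / u q) = 1" "\<forall>\<^sub>F q in ae. 1 / u q * u q = 1"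
      using nz by (eventually_elim, simp)+
    then show ?case
      using repr_carrier[OF g] repr_eq_iff[OF repr_mult[OF f g] repr_one]
        repr_eq_iff[OF repr_mult[OF g f] repr_one] by simp
  next
    case (2 y)
    then obtain v where y: "repr y v" by (auto elim: repr_carrierE)
    have "\<forall>\<^sub>F q in ae. u q * v q = 1"
      using 2 repr_eq_iff[OF repr_mult[OF f y] repr_one] by simp
    with nz have "\<forall>\<^sub>F q in ae. v q = 1 / u q"
      by eventually_elim (simp add: field_simps)
    then show ?case using repr_eq_iff[OF y g] by simp
  qed
  with g show ?thesis by simp
qed

lemma repr_diff_quot:
  assumes f: "repr f u" and g: "repr g v"
  shows "repr (diff_quot S f g) (deriv_quot S u v)"
proof -
  have "\<forall>\<^sub>F q in ae. deriv_quot S (\<lambda>q. the (f q)) (\<lambda>q. the (g q)) q = deriv_quot S u v q"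
    using assms by (intro deriv_quot_cong) (auto simp: repr_def)
  moreover have D: "mero_coord S (deriv_quot S u v)"
    using assms by (intro mero_coord_deriv_quot repr_mero_coord)
  ultimately have "diff_quot S f g = extend S (deriv_quot S u v)"
    using assms diff_quot_eq_extend extend_cong unfolding repr_def by simp
  with repr_extend[OF D] show ?thesis by simp
qed

lemma repr_nonconstant:
  assumes f: "repr f u" and nc: "nonconstant S f"
  shows "\<nexists>k. \<forall>\<^sub>F q in ae. u q = k"
proof
  assume "\<exists>k. \<forall>\<^sub>F q in ae. u q = k"
  then obtain k where "f = const_fun S (Some k)"
    using repr_eq_iff[OF f repr_const] by blast
  then show False using nc by (auto simp: nonconstant_def const_fun_def)
qed

text \<open>Because \<open>g\<close> is invariant, differentiation with respect to \<open>g\<close>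
  commutes with composition with \<open>A\<close>. Both laws thus result from differentiating the
  Moebius formula for \<open>u\<close> at \<open>A q\<close> once and twice.\<close>

lemma deriv_quot_equivariant:
  assumes A: "A \<in> carrier (Aut S)" and u: "mero_coord S u" and g: "mero_coord S g"
    and uA: "\<forall>\<^sub>F q in ae. c * u q + d \<noteq> 0 \<and> u (A q) = (a * u q + b) / (c * u q + d)"
    and gA: "\<forall>\<^sub>F q in ae. g (A q) = g q"
  defines "u' \<equiv> deriv_quot S u g"
  defines "u'' \<equiv> deriv_quot S u' g"
  shows "\<forall>\<^sub>F q in ae. u' (A q) = (a * d - b * c) * u' q / (c * u q + d)^2" (is ?th1)
    and "\<forall>\<^sub>F q in ae. u'' (A q) =
      (a * d - b * c) * (u'' q * (c * u q + d) - 2 * c * (u' q)^2) / (c * u q + d)^3" (is ?th2)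
proof -
  have u': "mero_coord S u'" unfolding u'_def using u g by (rule mero_coord_deriv_quot)
  have nz: "\<forall>\<^sub>F q in ae. c * u q + d \<noteq> 0" using uA by eventually_elim simp
  have uA': "\<forall>\<^sub>F q in ae. u (A q) = (a * u q + b) / (c * u q + d)" using uA by eventually_elim simp
  \<comment> \<open>The automorphism contributes the same chain rule factor to both derivatives of
    the quotient.\<close>
  have pull: "\<forall>\<^sub>F q in ae. deriv_quot S (\<lambda>x. v (A x)) (\<lambda>x. g (A x)) q = deriv_quot S v g (A q)"
    if v: "mero_coord S v" for v
    using eventually_codiscrete_pullback[OF A mero_coord_imp_analytic[OF v]]
      eventually_codiscrete_pullback[OF A mero_coord_imp_analytic[OF g]]
      eventually_codiscrete_in_surface
    by eventually_elim (rule deriv_quot_pullback[OF AutD(1,2)[OF A] _ AutD(3)[OF A]])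
  show ?th1
    using deriv_quot_cong[OF uA' gA] pull[OF u] mero_coord_imp_analytic[OF u] nz
      eventually_codiscrete_in_surface
    by eventually_elim (simp add: u'_def deriv_quot_moebius)
  then show ?th2
    using deriv_quot_cong[OF \<open>?th1\<close> gA] pull[OF u'] mero_coord_imp_analytic[OF u]
      mero_coord_imp_analytic[OF u'] nz eventually_codiscrete_in_surface
  proof eventually_elim
    case (elim q)
    have "u'' (A q) = deriv_quot S (\<lambda>x. (a * d - b * c) * u' x / (c * u x + d)^2) g q"
      using elim(2,3) by (simp only: u''_def)
    also have "\<dots> = (a * d - b * c) *
        (u'' q * (c * u q + d) - 2 * c * u' q * u' q) / (c * u q + d)^3"
      unfolding u''_def u'_def by (rule deriv_quot_weighted) (use elim in \<open>simp_all add: u'_def\<close>)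
    finally show ?case by (simp only: power2_eq_square mult.assoc)
  qed
qed

text \<open>\<open>s\<close> is half the logarithmic derivative of \<open>u'\<close>. Under
  \<open>A\<close> the function \<open>u'\<close> gains the factor (a d - b c) / (c u + d)^2: the
  constant determinant contributes nothing, and the inverse square contributes - c u' / (c u + d)
  after halving.\<close>

lemma half_log_deriv_equivariant:
  assumes A: "A \<in> carrier (Aut S)" and u: "mero_coord S u" and g: "mero_coord S g"
    and uA: "\<forall>\<^sub>F q in ae. c * u q + d \<noteq> 0 \<and> u (A q) = (a * u q + b) / (c * u q + d)"
    and gA: "\<forall>\<^sub>F q in ae. g (A q) = g q"
    and det: "a * d - b * c \<noteq> 0" and nz: "\<forall>\<^sub>F q in ae. deriv_quot S u g q \<noteq> 0"
  defines "u' \<equiv> deriv_quot S u g"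
  defines "s \<equiv> (\<lambda>q. 1/2 * (1 / u' q) * deriv_quot S u' g q)"
  shows "\<forall>\<^sub>F q in ae. s (A q) = s q - c * u' q / (c * u q + d)"
  using deriv_quot_equivariant[OF A u g uA gA] uA nz unfolding u'_def[symmetric]
proof eventually_elim
  case (elim q)
  \<comment> \<open>Here \<open>e\<close> is the determinant, \<open>w\<close> the denominator c u +
    d, and \<open>x\<close>, \<open>y\<close> are the first and second derivatives at
    \<open>q\<close>.\<close>
  have *: "1/2 * (1 / (e * x / w^2)) * (e * (y * w - 2 * c * x^2) / w^3) = 1/2 * (1 / x) * y - c * x / w"
    if "e \<noteq> 0" "w \<noteq> 0" "x \<noteq> 0" for e w x y :: complex
    using that by (simp add: divide_simps) (simp add: algebra_simps eval_nat_numeral)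
  show ?case
    unfolding s_def elim(1,2) by (rule *) (use elim det in auto)
qed

section \<open>Invariance and equivariance of representatives\<close>

lemma repr_moebius_equivariant_iff:
  fixes M :: "complex^2^2"
  assumes f: "repr f v" and A: "A \<in> carrier (Aut S)"
    and det: "M$1$1 * M$2$2 \<noteq> M$1$2 * M$2$1"
  shows "(\<forall>p\<in>carr. f (A p) = moebius_map M (f p)) \<longleftrightarrow>
    (\<forall>\<^sub>F q in ae. M$2$1 * v q + M$2$2 \<noteq> 0 \<and>
       v (A q) = (M$1$1 * v q + M$1$2) / (M$2$1 * v q + M$2$2))"
proof -
  have m: "meromorphic_function S f" and fv: "\<forall>\<^sub>F q in ae. the (f q) = v q"
    using f by (auto simp: repr_def)
  note fvA = eventually_codiscrete_pullback[OF A fv]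
  show ?thesis
    unfolding moebius_equivariant_iff[OF m A det]
  proof (rule eventually_subst)
    show "\<forall>\<^sub>F q in ae. (M$2$1 * the (f q) + M$2$2 \<noteq> 0 \<and>
       the (f (A q)) = (M$1$1 * the (f q) + M$1$2) / (M$2$1 * the (f q) + M$2$2)) \<longleftrightarrow>
       (M$2$1 * v q + M$2$2 \<noteq> 0 \<and> v (A q) = (M$1$1 * v q + M$1$2) / (M$2$1 * v q + M$2$2))"
      using fv fvA by eventually_elim simp
  qed
qed

lemma repr_invariant_iff:
  assumes f: "repr f v" and A: "A \<in> carrier (Aut S)"
  shows "(\<forall>p\<in>carr. f (A p) = f p) \<longleftrightarrow> (\<forall>\<^sub>F q in ae. v (A q) = v q)"
proof -
  have m: "meromorphic_function S f" and fv: "\<forall>\<^sub>F q in ae. the (f q) = v q"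
    using f by (auto simp: repr_def)
  note fvA = eventually_codiscrete_pullback[OF A fv]
  show ?thesis
    unfolding invariant_iff[OF m A]
  proof (rule eventually_subst)
    show "\<forall>\<^sub>F q in ae. (the (f (A q)) = the (f q)) \<longleftrightarrow> (v (A q) = v q)"
      using fv fvA by eventually_elim simp
  qed
qed

lemma repr_invariant_functions_iff:
  assumes "repr f v" "\<Gamma> \<subseteq> carrier (Aut S)"
  shows "f \<in> invariant_functions S \<Gamma> \<longleftrightarrow> (\<forall>A\<in>\<Gamma>. \<forall>\<^sub>F q in ae. v (A q) = v q)"
proof -
  have "f \<in> invariant_functions S \<Gamma> \<longleftrightarrow> (\<forall>A\<in>\<Gamma>. \<forall>p\<in>carr. f (A p) = f p)"
    using repr_carrier[OF assms(1)] by (simp add: invariant_functions_def)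
  also have "\<dots> \<longleftrightarrow> (\<forall>A\<in>\<Gamma>. \<forall>\<^sub>F q in ae. v (A q) = v q)"
    by (rule ball_cong[OF refl], rule repr_invariant_iff[OF assms(1)], rule subsetD[OF assms(2)])
  finally show ?thesis .
qed

lemma repr_equivariant_functions_iff:
  fixes M :: "_ \<Rightarrow> complex^2^2"
  assumes "repr f v" "\<Gamma> \<subseteq> carrier (Aut S)"
    and "\<And>A. A \<in> \<Gamma> \<Longrightarrow> M A $1$1 * M A $2$2 \<noteq> M A $1$2 * M A $2$1"
    and "\<And>A. A \<in> \<Gamma> \<Longrightarrow> pgl_act (\<rho> A) = moebius_map (M A)"
  shows "f \<in> equivariant_functions S \<Gamma> \<rho> \<longleftrightarrow>
    (\<forall>A\<in>\<Gamma>. \<forall>\<^sub>F q in ae. M A $2$1 * v q + M A $2$2 \<noteq> 0 \<and>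
       v (A q) = (M A $1$1 * v q + M A $1$2) / (M A $2$1 * v q + M A $2$2))"
proof -
  have "f \<in> equivariant_functions S \<Gamma> \<rho> \<longleftrightarrow>
      (\<forall>A\<in>\<Gamma>. \<forall>p\<in>carr. f (A p) = moebius_map (M A) (f p))"
    using repr_carrier[OF assms(1)] assms(4) by (simp add: equivariant_functions_def)
  also have "\<dots> \<longleftrightarrow> (\<forall>A\<in>\<Gamma>. \<forall>\<^sub>F q in ae. M A $2$1 * v q + M A $2$2 \<noteq> 0 \<and>
       v (A q) = (M A $1$1 * v q + M A $1$2) / (M A $2$1 * v q + M A $2$2))"
    by (rule ball_cong[OF refl], rule repr_moebius_equivariant_iff[OF assms(1) subsetD[OF assms(2)] assms(3)])
  finally show ?thesis .
qed

lemma const_None_equivariant_iff: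
  fixes M :: "_ \<Rightarrow> complex^2^2"
  assumes "\<Gamma> \<subseteq> carrier (Aut S)"
    and "\<And>A. A \<in> \<Gamma> \<Longrightarrow> pgl_act (\<rho> A) = moebius_map (M A)"
  shows "const_fun S None \<in> equivariant_functions S \<Gamma> \<rho> \<longleftrightarrow> (\<forall>A\<in>\<Gamma>. M A $2$1 = 0)"
proof -
  have "carr \<noteq> {}" using riemann_surface unfolding riemann_surface_def by blast
  then have "(\<forall>p\<in>carr. const_fun S None (A p) = pgl_act (\<rho> A) (const_fun S None p)) \<longleftrightarrow> M A $2$1 = 0"
    if "A \<in> \<Gamma>" for A
  proof -
    have "const_fun S None (A p) = pgl_act (\<rho> A) (const_fun S None p) \<longleftrightarrow> M A $2$1 = 0"
      if "p \<in> carr" for p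
      using that AutD(3)[OF subsetD[OF assms(1) \<open>A \<in> \<Gamma>\<close>] that] assms(2)[OF \<open>A \<in> \<Gamma>\<close>]
      by (simp add: const_fun_def)
    with \<open>carr \<noteq> {}\<close> show ?thesis by blast
  qed
  then show ?thesis by (simp add: equivariant_functions_def)
qed

end

section \<open>The bijection\<close>

text \<open>Naturality of the osculating transformation: with \<open>x\<close> and \<open>y\<close>
  the values of h - s at q and at A q, the left side is built from the values of f and f' at A q,
  and the right side is the Moebius image of the value at q.\<close>

lemma moebius_of_shift:
  fixes a b c d u \<alpha> x y :: complex
  assumes "c * u + d \<noteq> 0" "x \<noteq> 0" "y \<noteq> 0" "y = x + c * \<alpha> / (c * u + d)"
  shows "c * (u + \<alpha> / x) + d \<noteq> 0"
    and "(a * u + b) / (c * u + d) + (a * d - b * c) * \<alpha> / (c * u + d)^2 / y =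
      (a * (u + \<alpha> / x) + b) / (c * (u + \<alpha> / x) + d)"
proof -
  define w where "w = c * u + d"
  have w: "w \<noteq> 0" using assms by (simp add: w_def)
  have "y = x + c * \<alpha> / w" using assms(4) by (simp only: w_def)
  then have y: "y * w = x * w + c * \<alpha>" using w by (simp add: field_simps)
  \<comment> \<open>The new denominator is a multiple of \<open>y\<close>, so \<open>y\<close> being
    nonzero is what keeps the image finite.\<close>
  have den: "c * (u + \<alpha> / x) + d = y * w / x"
    using assms(2) unfolding y by (simp add: w_def field_simps)
  then show "c * (u + \<alpha> / x) + d \<noteq> 0" using w assms by simp
  have num: "a * (u + \<alpha> / x) + b = (x * (a * u + b) + a * \<alpha>) / x"
    using assms(2) by (simp add: field_simps)
  have key: "(a * u + b) * (y * w) + (a * d - b * c) * \<alpha> = (x * (a * u + b) + a * \<alpha>) * w"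
    unfolding y by (simp add: w_def algebra_simps)
  have "Z / w + E / w^2 / y = (Z * (y * w) + E) / (w * (y * w))" for Z E
    using w assms(3) by (simp add: add_divide_distrib power2_eq_square)
  from this[of "a * u + b" "(a * d - b * c) * \<alpha>"]
  have "(a * u + b) / w + (a * d - b * c) * \<alpha> / w^2 / y = (x * (a * u + b) + a * \<alpha>) / (y * w)"
    unfolding key using w by simp
  also have "\<dots> = (a * (u + \<alpha> / x) + b) / (c * (u + \<alpha> / x) + d)"
    unfolding den num using assms(2) by simp
  finally show "(a * u + b) / (c * u + d) + (a * d - b * c) * \<alpha> / (c * u + d)^2 / y =
      (a * (u + \<alpha> / x) + b) / (c * (u + \<alpha> / x) + d)"
    by (simp add: w_def)
qed

text \<open>The converse direction. The difference of two Moebius images is (a d - b c) (t - u) /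
  ((c t + d) (c u + d)), and writing c t + d = (c u + d) + c (t - u) splits off the shift.\<close>

lemma shift_of_moebius:
  fixes a b c d u \<alpha> t :: complex
  assumes "c * u + d \<noteq> 0" "c * t + d \<noteq> 0" "t \<noteq> u" "a * d - b * c \<noteq> 0"
  shows "(a * d - b * c) * \<alpha> / (c * u + d)^2 /
      ((a * t + b) / (c * t + d) - (a * u + b) / (c * u + d)) = \<alpha> / (t - u) + c * \<alpha> / (c * u + d)"
proof -
  define w x D where "w = c * u + d" "x = c * t + d" "D = a * d - b * c"
  have nz: "w \<noteq> 0" "x \<noteq> 0" "D \<noteq> 0" "t - u \<noteq> 0" using assms by (auto simp: w_x_D_def)
  have "(a * t + b) * w - (a * u + b) * x = D * (t - u)"
    by (simp add: w_x_D_def algebra_simps)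
  then have "(a * t + b) / x - (a * u + b) / w = D * (t - u) / (x * w)"
    using nz by (simp add: diff_frac_eq)
  moreover have "D * \<alpha> / w^2 / (D * r / (x * w)) = \<alpha> * x / (w * r)" if "r \<noteq> 0" for r
    using nz that by (simp add: power2_eq_square)
  from this[OF nz(4)] have "D * \<alpha> / w^2 / (D * (t - u) / (x * w)) = \<alpha> * x / (w * (t - u))" .
  moreover have "\<alpha> * x = \<alpha> * w + c * \<alpha> * (t - u)"
    by (simp add: w_x_D_def algebra_simps)
  then have "\<alpha> * x / (w * (t - u)) = \<alpha> / (t - u) + c * \<alpha> / w"
    using nz by (simp add: add_divide_distrib)
  ultimately show ?thesis by (simp add: w_x_D_def)
qed

theorem corollary8:
  fixes S :: "'a surface"
    and \<Gamma> :: "('a \<Rightarrow> 'a) set"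
    and \<rho> :: "('a \<Rightarrow> 'a) \<Rightarrow> (complex^2^2) set"
    and f g :: "'a \<Rightarrow> complex option"
  assumes "riemann_surface S"
    and "subgroup \<Gamma> (Aut S)"
    and "\<rho> \<in> hom (Aut S\<lparr>carrier := \<Gamma>\<rparr>) PGL2"
    and "\<exists>A\<in>\<Gamma>. \<rho> A \<noteq> \<one>\<^bsub>PGL2\<^esub>"
    and "f \<in> equivariant_functions S \<Gamma> \<rho>" and "nonconstant S f"
    and "g \<in> invariant_functions S \<Gamma>" and "nonconstant S g"
  shows
    "let R = mero_field S;
         f' = diff_quot S f g;
         f'' = diff_quot S f' g;
         k = (\<lambda>h. h \<ominus>\<^bsub>R\<^esub> const_fun S (Some (1/2)) \<otimes>\<^bsub>R\<^esub> inv\<^bsub>R\<^esub> f' \<otimes>\<^bsub>R\<^esub> f'')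
     in bij_betw
          (\<lambda>h. if k h = \<zero>\<^bsub>R\<^esub> then const_fun S None
               else f \<oplus>\<^bsub>R\<^esub> f' \<otimes>\<^bsub>R\<^esub> inv\<^bsub>R\<^esub> (k h))
          (invariant_functions S \<Gamma>)
          (equivariant_functions S \<Gamma> \<rho> - {f})"
proof -
  interpret Riemann_surface S by unfold_locales fact
  define R where "R = mero_field S"
  define f' where "f' = diff_quot S f g"
  define f'' where "f'' = diff_quot S f' g"
  define k where "k = (\<lambda>h. h \<ominus>\<^bsub>R\<^esub> const_fun S (Some (1/2)) \<otimes>\<^bsub>R\<^esub> inv\<^bsub>R\<^esub> f' \<otimes>\<^bsub>R\<^esub> f'')"
  define \<Phi> where "\<Phi> = (\<lambda>h. if k h = \<zero>\<^bsub>R\<^esub> then const_fun S None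
    else f \<oplus>\<^bsub>R\<^esub> f' \<otimes>\<^bsub>R\<^esub> inv\<^bsub>R\<^esub> (k h))"
  let ?I = "invariant_functions S \<Gamma>" and ?E = "equivariant_functions S \<Gamma> \<rho>"

  have \<Gamma>: "\<Gamma> \<subseteq> carrier (Aut S)" using assms(2) by (rule subgroup.subset)
  \<comment> \<open>Equivariance is a condition on each automorphism separately, so the matrices are
    chosen independently of each other.\<close>
  have "\<exists>M :: complex^2^2. M$1$1 * M$2$2 \<noteq> M$1$2 * M$2$1 \<and> pgl_act (\<rho> A) = moebius_map M"
    if "A \<in> \<Gamma>" for A
  proof -
    have "\<rho> A \<in> carrier PGL2" using assms(3) that by (auto simp: hom_def)
    then show ?thesis by (metis pgl_act_eq_moebius_map)
  qed
  then obtain M :: "('a \<Rightarrow> 'a) \<Rightarrow> complex^2^2"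
    where det: "\<And>A. A \<in> \<Gamma> \<Longrightarrow> M A $1$1 * M A $2$2 \<noteq> M A $1$2 * M A $2$1"
      and pgl: "\<And>A. A \<in> \<Gamma> \<Longrightarrow> pgl_act (\<rho> A) = moebius_map (M A)"
    by metis
  note equivariant_iff = repr_equivariant_functions_iff[where M = M and \<rho> = \<rho>, OF _ \<Gamma> det pgl]
  note invariant_iff = repr_invariant_functions_iff[OF _ \<Gamma>]
  note None_iff = const_None_equivariant_iff[where M = M and \<rho> = \<rho>, OF \<Gamma> pgl]

  \<comment> \<open>Being nonconstant, \<open>f\<close> is a genuine meromorphic function and has a
    finite-valued representative.\<close>
  have "f \<noteq> const_fun S None"
    using assms(6) by (auto simp: nonconstant_def const_fun_def)
  then obtain u where u: "repr f u"
    using assms(5) by (auto simp: equivariant_functions_def elim: repr_carrierE)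
  obtain w where w: "repr g w"
    using assms(7) by (auto simp: invariant_functions_def elim: repr_carrierE)
  define \<alpha> where "\<alpha> = deriv_quot S u w"
  define s where "s = (\<lambda>q. 1/2 * (1 / \<alpha> q) * deriv_quot S \<alpha> w q)"
  have \<alpha>: "repr f' \<alpha>" unfolding f'_def \<alpha>_def using u w by (rule repr_diff_quot)
  have f'': "repr f'' (deriv_quot S \<alpha> w)" unfolding f''_def using \<alpha> w by (rule repr_diff_quot)
  have \<alpha>_nz: "\<forall>\<^sub>F q in ae. \<alpha> q \<noteq> 0"
    unfolding \<alpha>_def
    by (intro deriv_quot_eventually_nonzero repr_mero_coord[OF u] repr_mero_coord[OF w]
        repr_nonconstant[OF u assms(6)] repr_nonconstant[OF w assms(8)])
  have s: "repr (const_fun S (Some (1/2)) \<otimes>\<^bsub>R\<^esub> inv\<^bsub>R\<^esub> f' \<otimes>\<^bsub>R\<^esub> f'') s"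
    unfolding R_def s_def by (intro repr_mult repr_const repr_inv \<alpha> \<alpha>_nz f'')
  have k: "repr (k h) (\<lambda>q. v q - s q)" if "repr h v" for h v
    unfolding k_def R_def using repr_minus[OF that s] by (simp add: R_def)
  have k_zero_iff: "k h = \<zero>\<^bsub>R\<^esub> \<longleftrightarrow> (\<forall>\<^sub>F q in ae. v q = s q)" if "repr h v" for h v
    using repr_eq_iff[OF k[OF that] repr_zero] by (simp add: R_def)
  \<comment> \<open>By the identity theorem, a difference that is not the zero function vanishes
    only on a discrete set; its inverse can then be computed pointwise.\<close>
  have k_nz: "\<forall>\<^sub>F q in ae. v q - s q \<noteq> 0" if "repr h v" "k h \<noteq> \<zero>\<^bsub>R\<^esub>" for h v
    using mero_coord_zero_or_nonzero[OF repr_mero_coord[OF k[OF that(1)]]] that k_zero_iff by simp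
  have \<Phi>: "repr (\<Phi> h) (\<lambda>q. u q + \<alpha> q * (1 / (v q - s q)))" if h: "repr h v" "k h \<noteq> \<zero>\<^bsub>R\<^esub>" for h v
  proof -
    have "\<Phi> h = f \<oplus>\<^bsub>R\<^esub> f' \<otimes>\<^bsub>R\<^esub> inv\<^bsub>R\<^esub> (k h)" using h(2) by (simp add: \<Phi>_def)
    then show ?thesis
      using repr_add[OF u repr_mult[OF \<alpha> repr_inv[OF k[OF h(1)] k_nz[OF h]]]] by (simp add: R_def)
  qed

  \<comment> \<open>Transformation laws under the group\<close>
  have uA: "\<forall>\<^sub>F q in ae. M A $2$1 * u q + M A $2$2 \<noteq> 0 \<and>
      u (A q) = (M A $1$1 * u q + M A $1$2) / (M A $2$1 * u q + M A $2$2)" if "A \<in> \<Gamma>" for A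
    using equivariant_iff[OF u] assms(5) that by blast
  have wA: "\<forall>\<^sub>F q in ae. w (A q) = w q" if "A \<in> \<Gamma>" for A
    using invariant_iff[OF w] assms(7) that by blast
  have \<alpha>A: "\<forall>\<^sub>F q in ae. \<alpha> (A q) =
      (M A $1$1 * M A $2$2 - M A $1$2 * M A $2$1) * \<alpha> q / (M A $2$1 * u q + M A $2$2)^2"
    if "A \<in> \<Gamma>" for A
    unfolding \<alpha>_def
    by (rule deriv_quot_equivariant(1)[OF _ repr_mero_coord[OF u] repr_mero_coord[OF w] uA wA])
       (use that \<Gamma> in auto)
  have sA: "\<forall>\<^sub>F q in ae. s (A q) = s q - M A $2$1 * \<alpha> q / (M A $2$1 * u q + M A $2$2)"
    if "A \<in> \<Gamma>" for A
    unfolding s_def \<alpha>_def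
    by (rule half_log_deriv_equivariant[OF _ repr_mero_coord[OF u] repr_mero_coord[OF w] uA wA])
       (use that \<Gamma> det \<alpha>_nz in \<open>auto simp: \<alpha>_def\<close>)

  \<comment> \<open>The correction term in \<open>sA\<close> has \<open>\<alpha>\<close> as a
    factor, which is nonzero almost everywhere, so it disappears only together with the matrix
    entry.\<close>
  have s_invariant_iff: "(\<forall>\<^sub>F q in ae. s (A q) = s q) \<longleftrightarrow> M A $2$1 = 0" if A: "A \<in> \<Gamma>" for A
  proof
    assume "\<forall>\<^sub>F q in ae. s (A q) = s q"
    with sA[OF A] \<alpha>_nz uA[OF A] have "\<forall>\<^sub>F q in ae. M A $2$1 = 0"
      by eventually_elim auto
    then show "M A $2$1 = 0" using codiscrete_neq_bot by (simp add: eventually_const_iff)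
  next
    assume "M A $2$1 = 0"
    then show "\<forall>\<^sub>F q in ae. s (A q) = s q" using sA[OF A] by simp
  qed
  have None_iff': "const_fun S None \<in> ?E \<longleftrightarrow> (\<forall>A\<in>\<Gamma>. \<forall>\<^sub>F q in ae. s (A q) = s q)"
    using None_iff s_invariant_iff by simp

  \<comment> \<open>Injectivity\<close>
  have "inj_on \<Phi> ?I"
  proof (rule inj_onI)
    fix h1 h2 assume h: "h1 \<in> ?I" "h2 \<in> ?I" and eq: "\<Phi> h1 = \<Phi> h2"
    obtain v1 v2 where v: "repr h1 v1" "repr h2 v2"
      using h by (auto simp: invariant_functions_def elim!: repr_carrierE)
    show "h1 = h2"
    proof (cases "k h1 = \<zero>\<^bsub>R\<^esub>"; cases "k h2 = \<zero>\<^bsub>R\<^esub>")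
      assume "k h1 = \<zero>\<^bsub>R\<^esub>" "k h2 = \<zero>\<^bsub>R\<^esub>"
      then have "\<forall>\<^sub>F q in ae. v1 q = s q" "\<forall>\<^sub>F q in ae. v2 q = s q"
        using v k_zero_iff by blast+
      then have "\<forall>\<^sub>F q in ae. v1 q = v2 q" by eventually_elim simp
      then show ?thesis using repr_eq_iff[OF v] by simp
    next
      assume "k h1 = \<zero>\<^bsub>R\<^esub>" "k h2 \<noteq> \<zero>\<^bsub>R\<^esub>"
      then have "repr (const_fun S None) (\<lambda>q. u q + \<alpha> q * (1 / (v2 q - s q)))"
        using \<Phi>[OF v(2)] eq by (simp add: \<Phi>_def)
      then show ?thesis using not_meromorphic_const_None by (simp add: repr_def)
    next
      assume "k h1 \<noteq> \<zero>\<^bsub>R\<^esub>" "k h2 = \<zero>\<^bsub>R\<^esub>"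
      then have "repr (const_fun S None) (\<lambda>q. u q + \<alpha> q * (1 / (v1 q - s q)))"
        using \<Phi>[OF v(1)] eq by (simp add: \<Phi>_def)
      then show ?thesis using not_meromorphic_const_None by (simp add: repr_def)
    next
      assume nz: "k h1 \<noteq> \<zero>\<^bsub>R\<^esub>" "k h2 \<noteq> \<zero>\<^bsub>R\<^esub>"
      have "\<forall>\<^sub>F q in ae. u q + \<alpha> q * (1 / (v1 q - s q)) = u q + \<alpha> q * (1 / (v2 q - s q))"
        using repr_eq_iff[OF \<Phi>[OF v(1) nz(1)] \<Phi>[OF v(2) nz(2)]] eq by simp
      with \<alpha>_nz k_nz[OF v(1) nz(1)] k_nz[OF v(2) nz(2)] have "\<forall>\<^sub>F q in ae. v1 q = v2 q"
        by eventually_elim auto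
      then show ?thesis using repr_eq_iff[OF v] by simp
    qed
  qed

  \<comment> \<open>Values are equivariant and different from \<open>f\<close>\<close>
  moreover have "\<Phi> h \<in> ?E - {f}" if h: "h \<in> ?I" for h
  proof -
    obtain v where v: "repr h v"
      using h by (auto simp: invariant_functions_def elim: repr_carrierE)
    have vA: "\<forall>\<^sub>F q in ae. v (A q) = v q" if "A \<in> \<Gamma>" for A
      using invariant_iff[OF v] h that by blast
    show ?thesis
    proof (cases "k h = \<zero>\<^bsub>R\<^esub>")
      case True
      \<comment> \<open>In the degenerate case \<open>s\<close> inherits invariance from
        \<open>v\<close>; the equality is used both at \<open>q\<close> and, through pullback, at
        \<open>A q\<close>.\<close>
      then have vs: "\<forall>\<^sub>F q in ae. v q = s q" using k_zero_iff[OF v] by simp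
      have "\<forall>\<^sub>F q in ae. s (A q) = s q" if A: "A \<in> \<Gamma>" for A
        using vs eventually_codiscrete_pullback[OF subsetD[OF \<Gamma> A] vs] vA[OF A]
        by eventually_elim simp
      then show ?thesis
        using True None_iff' \<open>f \<noteq> const_fun S None\<close> by (simp add: \<Phi>_def)
    next
      case False
      note nz = k_nz[OF v False]
      have "\<forall>\<^sub>F q in ae.
          M A $2$1 * (u q + \<alpha> q * (1 / (v q - s q))) + M A $2$2 \<noteq> 0 \<and>
          u (A q) + \<alpha> (A q) * (1 / (v (A q) - s (A q))) =
          (M A $1$1 * (u q + \<alpha> q * (1 / (v q - s q))) + M A $1$2) /
          (M A $2$1 * (u q + \<alpha> q * (1 / (v q - s q))) + M A $2$2)" if A: "A \<in> \<Gamma>" for A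
        using nz eventually_codiscrete_pullback[OF subsetD[OF \<Gamma> A] nz] vA[OF A] uA[OF A]
          \<alpha>A[OF A] sA[OF A]
      proof eventually_elim
        case (elim q)
        \<comment> \<open>As \<open>v\<close> is invariant, v - s changes by the negative of the
          change of \<open>s\<close>, which is the shift required in
          \<open>moebius_of_shift\<close>.\<close>
        have "v (A q) - s (A q) = v q - s q + M A $2$1 * \<alpha> q / (M A $2$1 * u q + M A $2$2)"
          using elim(3,6) by simp
        from moebius_of_shift[OF _ elim(1,2) this] elim(4,5) show ?case by simp
      qed
      then have "\<Phi> h \<in> ?E" using equivariant_iff[OF \<Phi>[OF v False]] by simp
      moreover have "\<Phi> h \<noteq> f"
      proof
        assume "\<Phi> h = f"
        then have "\<forall>\<^sub>F q in ae. u q + \<alpha> q * (1 / (v q - s q)) = u q"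
          using repr_eq_iff[OF \<Phi>[OF v False] u] by simp
        with \<alpha>_nz nz have "\<forall>\<^sub>F q in ae. False" by eventually_elim simp
        then show False using codiscrete_neq_bot by (simp add: trivial_limit_def)
      qed
      ultimately show ?thesis by simp
    qed
  qed

  \<comment> \<open>Surjectivity\<close>
  moreover have "\<exists>h\<in>?I. \<Phi> h = F" if F: "F \<in> ?E - {f}" for F
  proof (cases "F = const_fun S None")
    case True
    \<comment> \<open>Only k h = 0 produces the constant infinity, which forces h = s; equivariance
      of that constant makes \<open>s\<close> invariant.\<close>
    let ?h = "extend S s"
    have h: "repr ?h s" using s by (intro repr_extend repr_mero_coord)
    have "?h \<in> ?I" using invariant_iff[OF h] None_iff' F True by simp
    moreover have "\<Phi> ?h = F" using k_zero_iff[OF h] True by (simp add: \<Phi>_def)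
    ultimately show ?thesis by blast
  next
    case False
    then obtain t where t: "repr F t"
      using F by (auto simp: equivariant_functions_def elim: repr_carrierE)
    have "\<not> (\<forall>\<^sub>F q in ae. t q - u q = 0)" using repr_eq_iff[OF t u] F by simp
    then have tu: "\<forall>\<^sub>F q in ae. t q \<noteq> u q"
      using mero_coord_zero_or_nonzero[OF mero_coord_intros(3)[OF repr_mero_coord[OF t] repr_mero_coord[OF u]]]
      by simp
    have tA: "\<forall>\<^sub>F q in ae. M A $2$1 * t q + M A $2$2 \<noteq> 0 \<and>
        t (A q) = (M A $1$1 * t q + M A $1$2) / (M A $2$1 * t q + M A $2$2)" if "A \<in> \<Gamma>" for A
      using equivariant_iff[OF t] F that by blast
    \<comment> \<open>The equation F = f + f' / (h - s), solved for h. Under \<open>A\<close> the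
      quotient gains the shift found in \<open>shift_of_moebius\<close>, and \<open>s\<close> loses
      the same amount.\<close>
    define v where "v = (\<lambda>q. \<alpha> q / (t q - u q) + s q)"
    let ?h = "extend S v"
    have h: "repr ?h v"
      unfolding v_def using s \<alpha> t u by (intro repr_extend mero_coord_intros repr_mero_coord)
    have "\<forall>\<^sub>F q in ae. v (A q) = v q" if A: "A \<in> \<Gamma>" for A
      using tu tA[OF A] uA[OF A] \<alpha>A[OF A] sA[OF A]
    proof eventually_elim
      case (elim q)
      then show ?case
        using shift_of_moebius[of "M A $2$1" "u q" "M A $2$2" "t q" "M A $1$1" "M A $1$2" "\<alpha> q"]
          det[OF A] by (simp add: v_def)
    qed
    then have "?h \<in> ?I" using invariant_iff[OF h] by simp
    moreover have "\<Phi> ?h = F"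
    proof -
      have nz: "k ?h \<noteq> \<zero>\<^bsub>R\<^esub>"
      proof
        assume "k ?h = \<zero>\<^bsub>R\<^esub>"
        then have "\<forall>\<^sub>F q in ae. v q = s q" using k_zero_iff[OF h] by simp
        with \<alpha>_nz tu have "\<forall>\<^sub>F q in ae. False" by eventually_elim (simp add: v_def)
        then show False using codiscrete_neq_bot by (simp add: trivial_limit_def)
      qed
      have "\<forall>\<^sub>F q in ae. u q + \<alpha> q * (1 / (v q - s q)) = t q"
        using \<alpha>_nz tu by eventually_elim (simp add: v_def)
      then show ?thesis using repr_eq_iff[OF \<Phi>[OF h nz] t] by simp
    qed
    ultimately show ?thesis by blast
  qed
  ultimately have "bij_betw \<Phi> ?I (?E - {f})"
    unfolding bij_betw_def by blast
  then show ?thesis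
    unfolding Let_def \<Phi>_def k_def f''_def f'_def R_def .
qed

end
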